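(* For each $n \ge 0$, let $a_n$ denote the number of involutions of length $n$ that avoid the pattern $2431$. Then the (ordinary) generating function of this sequence is \[ \sum_{n\ge 0} a_n x^n \;=\; \frac{1-2x-5x^2+8x^3+3x^4+2x^5+x^4\sqrt{1-4x^2}}{(1-x)(1-2x-6x^2+8x^3+8x^4+4x^5)}, \] as an identity of formal power series in $x$, where $\sqrt{1-4x^2}$ denotes the formal power series square root with constant term $1$.
   Context: A permutation of length $n$ is a bijection $\pi$ from $\{1,\dots,n\}$ to itself, written in one-line notation $\pi=\pi(1)\pi(2)\cdots\pi(n)$. It is an involution if $\pi=\pi^{-1}$, i.e. $\pi(\pi(i))=i$ for all $i$. The unique (empty) permutation of length $0$ counts as an involution, so $a_0=1$. A permutation $\pi$ of length $n$ contains a permutation $\sigma$ of length $k$ as a pattern if there exist indices $1\le i_1<i_2<\cdots<i_k\le n$ such that, for all $a,b\in\{1,\dots,k\}$, $\pi(i_a)<\pi(i_b)$ if and only if $\sigma(a)<\sigma(b)$. Otherwise $\pi$ avoids $\sigma$. Here $2431$ denotes the permutation $\sigma$ of length $4$ with $\sigma(1)=2$, $\sigma(2)=4$, $\sigma(3)=3$, $\sigma(4)=1$. *)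

theory Defs
  imports
    Complex_Main
    "HOL-Computational_Algebra.Formal_Power_Series"
    "HOL-Combinatorics.Permutations"
begin

text \<open>
  A permutation of length n is a function p with \<open>p permutes {1..n}\<close>; by the library's
  convention it is the identity outside \<open>{1..n}\<close>, so each bijection of \<open>{1..n}\<close> is
  represented by exactly one such function.
\<close>

definition one_line :: "nat list \<Rightarrow> nat \<Rightarrow> nat" where
  "one_line xs i = (if i \<in> {1..length xs} then xs ! (i - 1) else i)"

text \<open>The length n of \<open>p\<close> and the length k of the pattern \<open>s\<close> are passed explicitly.\<close>

definition contains_pattern ::
    "nat \<Rightarrow> (nat \<Rightarrow> nat) \<Rightarrow> nat \<Rightarrow> (nat \<Rightarrow> nat) \<Rightarrow> bool" where
  "contains_pattern n p k s \<longleftrightarrow>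
     (\<exists>idx. idx ` {1..k} \<subseteq> {1..n} \<and> strict_mono_on {1..k} idx \<and>
        (\<forall>a\<in>{1..k}. \<forall>b\<in>{1..k}. p (idx a) < p (idx b) \<longleftrightarrow> s a < s b))"

definition avoids_pattern ::
    "nat \<Rightarrow> (nat \<Rightarrow> nat) \<Rightarrow> nat \<Rightarrow> (nat \<Rightarrow> nat) \<Rightarrow> bool" where
  "avoids_pattern n p k s \<longleftrightarrow> \<not> contains_pattern n p k s"

definition avoiding_involutions :: "nat \<Rightarrow> nat \<Rightarrow> (nat \<Rightarrow> nat) \<Rightarrow> (nat \<Rightarrow> nat) set" where
  "avoiding_involutions n k s = {p. p permutes {1..n} \<and> p = inv p \<and> avoids_pattern n p k s}"

definition pattern_2431 :: "nat \<Rightarrow> nat" where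
  "pattern_2431 = one_line [2, 4, 3, 1]"

lemma pattern_2431_simps:
  "pattern_2431 1 = 2" "pattern_2431 2 = 4" "pattern_2431 3 = 3" "pattern_2431 4 = 1"
  by (simp_all add: pattern_2431_def one_line_def)

definition num_inv_avoiding_2431 :: "nat \<Rightarrow> nat" where
  "num_inv_avoiding_2431 n = card (avoiding_involutions n 4 pattern_2431)"

lemma finite_avoiding_involutions: "finite (avoiding_involutions n k s)"
  by (rule finite_subset[OF _ finite_permutations[of "{1..n}"]])
     (auto simp: avoiding_involutions_def)

definition fps_sqrt :: "real fps \<Rightarrow> real fps" where
  "fps_sqrt f = fps_radical root 2 f"

lemma fps_sqrt_unique:
  assumes "fps_nth f 0 = 1"
  shows "s = fps_sqrt f \<longleftrightarrow> s\<^sup>2 = f \<and> fps_nth s 0 = 1"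
proof -
  have ex: "(fps_sqrt f)\<^sup>2 = f" "fps_nth (fps_sqrt f) 0 = 1"
    using power_radical[of f root 1] assms
    by (simp_all add: fps_sqrt_def numeral_2_eq_2)
  have "s = fps_sqrt f" if "s\<^sup>2 = f" "fps_nth s 0 = 1"
  proof -
    have "s = fps_sqrt f \<or> s = - fps_sqrt f"
      using that(1) ex(1) by (metis power2_eq_iff)
    thus ?thesis using that(2) ex(2) by auto
  qed
  with ex show ?thesis by blast
qed

end

theory Submission
  imports Defs
begin

text \<open>
  An avoider is the direct sum of its connected components, so it suffices to count the connected ones.
  Let \<open>\<pi>\<close> be connected of length at least 2 and \<open>k = \<pi>(1)\<close>. It avoids 2431 iff the columns strictly
  between 1 and \<open>k\<close> avoid 132 and the arcs \<open>(i, \<pi>(i))\<close> with \<open>i < \<pi>(i)\<close> and \<open>\<pi>(i) > k\<close> are pairwise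
  non-nested. The part beyond \<open>k\<close> is then a first-in-first-out queue, determined by a ballot word, so
  each of its initial elements contributes a factor \<open>x c\<close>, where \<open>c = 1 + x\<^sup>2 c\<^sup>2\<close>. Between 1
  and \<open>k\<close> the points entering the queue can only be inserted at the skew cuts of a
  132-avoiding involution, which is peeled from outside: such an involution either fixes its last point
  or has an outer layer consisting of a 132-avoiding bijection and its inverse. Writing \<open>B\<close> for the series of 132-avoiding involutions, the middle part together with
  the queue has series \<open>E = c + c\<^sup>2 (x B + x\<^sup>2 c E)\<close>, connected avoiders have series \<open>x + x\<^sup>2 E\<close>, and
  \<open>\<surd>(1 - 4 x\<^sup>2) = 1 - 2 x\<^sup>2 c\<close>.
\<close>

section \<open>Involutions and gluing\<close>

text \<open>The obstacle is the interaction of the middle part with the queue: points between 1 and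
  \<open>k\<close> may be joined to points beyond \<open>k\<close>. Non-nesting removes it. Waiting
  points are served in order, so only their number \<open>r\<close> matters, and \<open>r\<close>
  enters the series of the middle part only through a factor \<open>(x c)^r\<close>. Hence a middle
  point entering the queue has weight \<open>x\<close> for itself times \<open>x c\<close>, and a
  run of such points at one end of the middle has series \<open>1 / (1 - x^2 c) = c\<close>. The
  runs at the two ends give the factor \<open>c^2\<close> in the equation for \<open>E\<close>; the
  separate summand \<open>c\<close> is the case where every middle point enters the queue. Once both
  runs are stripped, 132-avoidance leaves two cases. Either the last point is fixed, and then no
  remaining point can enter the queue, which gives \<open>x B\<close>; or the two ends carry an
  outer layer, which gives \<open>x^2 c\<close> times a smaller middle part with its queue.\<close>

definition inv_on :: "nat set \<Rightarrow> (nat \<Rightarrow> nat) \<Rightarrow> bool" where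
  "inv_on S p \<longleftrightarrow> (\<forall>x. p (p x) = x) \<and> (\<forall>x. x \<notin> S \<longrightarrow> p x = x)"

lemma inv_on_invol: "inv_on S p \<Longrightarrow> p (p x) = x"
  by (simp add: inv_on_def)

lemma inv_on_outside: "inv_on S p \<Longrightarrow> x \<notin> S \<Longrightarrow> p x = x"
  by (simp add: inv_on_def)

lemma inv_on_mem: "inv_on S p \<Longrightarrow> x \<in> S \<Longrightarrow> p x \<in> S"
  by (metis inv_on_def)

lemma inv_on_eq_iff: "inv_on S p \<Longrightarrow> p x = p y \<longleftrightarrow> x = y"
  by (metis inv_on_def)

lemma inv_on_iff_permutes: "inv_on S p \<longleftrightarrow> p permutes S \<and> p = inv p"
proof
  assume p: "inv_on S p"
  have i: "p (p x) = x" for x using p by (rule inv_on_invol)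
  have "p permutes S"
    unfolding permutes_def
  proof (intro conjI allI impI)
    fix y show "\<exists>!x. p x = y"
      by (rule ex1I[of _ "p y"]) (auto simp: i)
  qed (rule inv_on_outside[OF p])
  moreover have "p = inv p"
    by (rule inv_equality[symmetric]) (rule i)+
  ultimately show "p permutes S \<and> p = inv p" by simp
next
  assume p: "p permutes S \<and> p = inv p"
  then have "p (p x) = x" for x
    by (metis permutes_inverses(2))
  with p show "inv_on S p"
    by (auto simp: inv_on_def permutes_not_in)
qed

lemma finite_inv_on: "finite S \<Longrightarrow> finite {p. inv_on S p}"
  by (rule finite_subset[OF _ finite_permutations[of S]]) (use inv_on_iff_permutes in blast)

definition restr :: "nat set \<Rightarrow> (nat \<Rightarrow> nat) \<Rightarrow> nat \<Rightarrow> nat" where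
  "restr S p x = (if x \<in> S then p x else x)"

text \<open>Involutions are total functions fixing everything outside their point set, so the pieces
  of a decomposition are put together by plain composition, without relabelling. Every structural
  decomposition below is phrased with \<open>glue\<close>, and \<open>card_glue\<close> turns it
  into a product.\<close>

definition glue :: "(nat \<Rightarrow> nat) set \<Rightarrow> (nat \<Rightarrow> nat) set \<Rightarrow> (nat \<Rightarrow> nat) set" where
  "glue P Q = (\<lambda>(p, q). p \<circ> q) ` (P \<times> Q)"

lemma comp_inv_on:
  assumes "inv_on S p" "inv_on T q" "S \<inter> T = {}"
  shows "(p \<circ> q) x = (if x \<in> S then p x else q x)"
proof (cases "x \<in> T")
  case True
  then have "q x \<in> T" by (rule inv_on_mem[OF assms(2)])
  with True assms(3) have "x \<notin> S" "q x \<notin> S" by auto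
  then show ?thesis using inv_on_outside[OF assms(1), of "q x"] by simp
next
  case False
  then have "q x = x" by (rule inv_on_outside[OF assms(2)])
  then show ?thesis using inv_on_outside[OF assms(1), of x] by simp
qed

lemma inv_on_comp:
  assumes "inv_on S p" "inv_on T q" "S \<inter> T = {}"
  shows "inv_on (S \<union> T) (p \<circ> q)"
proof -
  note c = comp_inv_on[OF assms]
  have "(p \<circ> q) ((p \<circ> q) x) = x" for x
  proof (cases "x \<in> S")
    case True
    then show ?thesis
      unfolding c using inv_on_mem[OF assms(1) True] inv_on_invol[OF assms(1), of x] by simp
  next
    case False
    then have "q x \<notin> S"
      using inv_on_mem[OF assms(2), of x] inv_on_outside[OF assms(2), of x] assms(3) by (cases "x \<in> T") auto
    with False show ?thesis
      unfolding c using inv_on_invol[OF assms(2), of x] by simp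
  qed
  moreover have "(p \<circ> q) x = x" if "x \<notin> S \<union> T" for x
    unfolding c using that inv_on_outside[OF assms(2), of x] by simp
  ultimately show ?thesis by (simp only: inv_on_def) simp
qed

lemma inv_on_restr:
  assumes "inv_on S p" "p ` T \<subseteq> T"
  shows "inv_on T (restr T p)"
  using assms by (auto simp: inv_on_def restr_def)

text \<open>A point of \<open>T\<close> sent into \<open>S\<close> would have to return to
  \<open>S\<close> under a second application of \<open>p\<close>. Thus a splitting only needs
  invariance of one side.\<close>

lemma image_complement_inv_on:
  assumes "inv_on (S \<union> T) p" "p ` S \<subseteq> S" "S \<inter> T = {}"
  shows "p ` T \<subseteq> T"
proof
  fix y assume "y \<in> p ` T"
  then obtain x where x: "x \<in> T" "y = p x" by auto
  have "y \<in> S \<union> T" using inv_on_mem[OF assms(1), of x] x by simp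
  moreover have False if "y \<in> S"
  proof -
    have "p y \<in> S" using that assms(2) by auto
    then show False using x assms(3) inv_on_invol[OF assms(1), of x] by auto
  qed
  ultimately show "y \<in> T" by auto
qed

lemma glue_restr:
  assumes "inv_on (S \<union> T) p" "p ` S \<subseteq> S" "S \<inter> T = {}"
    "restr S p \<in> P" "restr T p \<in> Q"
  shows "p \<in> glue P Q"
proof -
  have "p = restr S p \<circ> restr T p"
    using comp_inv_on[OF inv_on_restr[OF assms(1,2)]
        inv_on_restr[OF assms(1) image_complement_inv_on[OF assms(1-3)]] assms(3)] assms(1)
    by (auto simp: restr_def fun_eq_iff inv_on_outside)
  with assms(4,5) show ?thesis
    by (auto simp: glue_def image_iff)
qed

lemma glueE:
  assumes "r \<in> glue P Q" "P \<subseteq> {p. inv_on S p}" "Q \<subseteq> {p. inv_on T p}" "S \<inter> T = {}"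
  obtains p q where "p \<in> P" "q \<in> Q" "inv_on S p" "inv_on T q" "inv_on (S \<union> T) r"
    "\<And>x. r x = (if x \<in> S then p x else q x)"
proof -
  obtain p q where pq: "p \<in> P" "q \<in> Q" "r = p \<circ> q"
    using assms(1) by (auto simp: glue_def)
  then have i: "inv_on S p" "inv_on T q"
    using assms by auto
  show thesis
    by (rule that[of p q])
      (use pq i comp_inv_on[OF i assms(4)] inv_on_comp[OF i assms(4)] in auto)
qed

lemma card_glue:
  assumes P: "P \<subseteq> {p. inv_on S p}" and Q: "Q \<subseteq> {p. inv_on T p}" and d: "S \<inter> T = {}"
  shows "card (glue P Q) = card P * card Q"
proof -
  have "inj_on (\<lambda>(p, q). p \<circ> q) (P \<times> Q)"
  proof (rule inj_onI, clarify)
    fix p q p' q'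
    assume m: "p \<in> P" "q \<in> Q" "p' \<in> P" "q' \<in> Q" and e: "p \<circ> q = p' \<circ> q'"
    then have i: "inv_on S p" "inv_on T q" "inv_on S p'" "inv_on T q'"
      using P Q by auto
    have e': "(if x \<in> S then p x else q x) = (if x \<in> S then p' x else q' x)" for x
      using fun_cong[OF e, of x] comp_inv_on[OF i(1,2) d] comp_inv_on[OF i(3,4) d] by simp
    have "p x = p' x" for x
      using e'[of x] i by (cases "x \<in> S") (auto simp: inv_on_outside)
    moreover have "q x = q' x" for x
    proof (cases "x \<in> S")
      case True
      with d have "x \<notin> T" by auto
      with i show ?thesis by (simp add: inv_on_outside)
    next
      case False
      with e'[of x] show ?thesis by simp
    qed
    ultimately show "p = p' \<and> q = q'" by auto
  qed
  then show ?thesis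
    by (simp add: glue_def card_image card_cartesian_product)
qed

text \<open>A one-element family rather than a function, so that removing a 2-cycle is an instance
  of \<open>glue\<close>.\<close>

definition arc :: "nat \<Rightarrow> nat \<Rightarrow> (nat \<Rightarrow> nat) set" where
  "arc a b = {transpose a b}"

lemma arc_inv_on: "arc a b \<subseteq> {p. inv_on {a, b} p}"
  by (auto simp: arc_def inv_on_def)

lemma card_arc [simp]: "card (arc a b) = 1"
  by (simp add: arc_def)

lemma arcD: "p \<in> arc a b \<Longrightarrow> p a = b \<and> p b = a"
  by (simp add: arc_def)

lemma restr_arc: "inv_on S p \<Longrightarrow> p a = b \<Longrightarrow> restr {a, b} p \<in> arc a b"
  using inv_on_invol[of S p a] by (auto simp: arc_def restr_def transpose_def fun_eq_iff)

section \<open>The structure of connected avoiders\<close>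

text \<open>Only the positions are restricted to \<open>M\<close>. The values may leave
  \<open>M\<close>, since points of the middle interval may be joined to points of
  \<open>Z\<close>.\<close>

definition avoids_132_on :: "nat set \<Rightarrow> (nat \<Rightarrow> nat) \<Rightarrow> bool" where
  "avoids_132_on M p \<longleftrightarrow>
     (\<forall>i\<in>M. \<forall>j\<in>M. \<forall>k\<in>M. i < j \<longrightarrow> j < k \<longrightarrow> p i < p k \<longrightarrow> p j \<le> p k)"

text \<open>These are the involutions left after removing the arc \<open>(a, k)\<close> of the smallest point \<open>a\<close> of a
  connected avoider: \<open>M\<close> is the interval between \<open>a\<close> and \<open>k\<close>, \<open>Z\<close> the interval above \<open>k\<close>, and \<open>R\<close>
  (initially empty) collects the points already known to be joined to a point of \<open>Z\<close>. Arcs ending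
  in \<open>Z\<close> are never nested, so their left ends form a queue. The last condition says that no \<open>z \<in> Z\<close>
  starts a new sum component.\<close>

definition queue_invs :: "nat set \<Rightarrow> nat set \<Rightarrow> nat set \<Rightarrow> (nat \<Rightarrow> nat) set" where
  "queue_invs R M Z = {p. inv_on (R \<union> M \<union> Z) p \<and> p ` R \<subseteq> Z \<and> avoids_132_on M p \<and>
     (\<forall>i j. i < j \<longrightarrow> j \<le> p j \<longrightarrow> p j \<in> Z \<longrightarrow> p i < p j) \<and> (\<forall>z\<in>Z. \<exists>i<z. z \<le> p i)}"

lemma queue_invs_subset: "queue_invs R M Z \<subseteq> {p. inv_on (R \<union> M \<union> Z) p}"
  unfolding queue_invs_def by blast

lemma finite_queue_invs: "finite R \<Longrightarrow> finite M \<Longrightarrow> finite Z \<Longrightarrow> finite (queue_invs R M Z)"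
  by (rule finite_subset[OF queue_invs_subset finite_inv_on]) auto

lemma queue_invsD:
  assumes "p \<in> queue_invs R M Z"
  shows "inv_on (R \<union> M \<union> Z) p" "x \<in> R \<Longrightarrow> p x \<in> Z" "avoids_132_on M p"
    "i < j \<Longrightarrow> j \<le> p j \<Longrightarrow> p j \<in> Z \<Longrightarrow> p i < p j"
    "z \<in> Z \<Longrightarrow> \<exists>i<z. z \<le> p i"
  using assms unfolding queue_invs_def by blast+

text \<open>A fixed point counts as an arc ending at itself: the non-nesting condition would push
  all earlier values below it, while the last condition asks for an arc passing over it.\<close>

lemma queue_no_fixed:
  assumes p: "p \<in> queue_invs R M Z" "z \<in> Z"
  shows "p z \<noteq> z"
proof
  assume z: "p z = z"
  obtain i where i: "i < z" "z \<le> p i"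
    using queue_invsD(5)[OF p] by blast
  have "p i < p z"
    by (rule queue_invsD(4)[OF p(1) i(1)]) (simp_all add: z p(2))
  with i z show False by simp
qed

section \<open>Empty middle: serving the queue one point at a time\<close>

lemma queue_invs_empty: "queue_invs {} {} {} = {id}"
proof -
  have "p = id" if "p \<in> queue_invs {} {} {}" for p
    using inv_on_outside[OF queue_invsD(1)[OF that]] by (intro ext) simp
  moreover have "id \<in> queue_invs {} {} {}"
    by (simp add: queue_invs_def inv_on_def avoids_132_on_def)
  ultimately show ?thesis by blast
qed

lemma queue_invs_empty_left:
  assumes "c < e"
  shows "queue_invs {} {} {c..<e} = {}"
proof -
  have False if p: "p \<in> queue_invs {} {} {c..<e}" for p
  proof -
    obtain i where i: "i < c" "c \<le> p i"
      using queue_invsD(5)[OF p, of c] assms by auto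
    have "p i = i"
      by (rule inv_on_outside[OF queue_invsD(1)[OF p]]) (use i in auto)
    with i show False by simp
  qed
  then show ?thesis by blast
qed

lemma queue_invs_empty_right: "R \<noteq> {} \<Longrightarrow> queue_invs R M {} = {}"
  unfolding queue_invs_def by blast

text \<open>The first point \<open>c\<close> of \<open>Z\<close> either closes an open arc or opens
  a new one. Being first in, first out, the queue leaves no choice in the first case: the arc closed
  is the one starting at \<open>Min R\<close>.\<close>

lemma queue_invs_step:
  assumes fin: "finite R" and ne: "R \<noteq> {}" and lt: "\<forall>x\<in>R. x < c" and ce: "c < e"
  defines "r \<equiv> Min R"
  shows "queue_invs R {} {c..<e} =
    glue (arc r c) (queue_invs (R - {r}) {} {Suc c..<e}) \<union> queue_invs (insert c R) {} {Suc c..<e}"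
    (is "?L = ?G \<union> ?O")
proof -
  have r: "r \<in> R" "\<And>x. x \<in> R \<Longrightarrow> r \<le> x" "r < c"
    using fin ne lt by (auto simp: r_def)
  have un: "{r, c} \<union> (R - {r} \<union> {} \<union> {Suc c..<e}) = R \<union> {} \<union> {c..<e}"
    using r ce by auto
  have disj: "{r, c} \<inter> (R - {r} \<union> {} \<union> {Suc c..<e}) = {}"
    using lt r by auto
  have 1: "p \<in> ?G \<union> ?O" if p: "p \<in> ?L" for p
  proof (cases "p c < c")
    case True
    have i: "inv_on (R \<union> {} \<union> {c..<e}) p" and E: "\<And>i j. i < j \<Longrightarrow> j \<le> p j \<Longrightarrow> p j \<in> {c..<e} \<Longrightarrow> p i < p j"
      and cn: "\<And>z. z \<in> {c..<e} \<Longrightarrow> \<exists>i<z. z \<le> p i" and R: "p ` R \<subseteq> {c..<e}"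
      using queue_invsD[OF p] by blast+
    have "p c \<in> R"
      using inv_on_mem[OF i, of c] True ce by auto
    \<comment> \<open>If a later opener were closed at \<open>c\<close>, the arc from
      \<open>r\<close>, which ends at or after \<open>c\<close>, would enclose it.\<close>
    have pc: "p c = r"
    proof (rule ccontr)
      assume "p c \<noteq> r"
      with r(2)[OF \<open>p c \<in> R\<close>] have "r < p c" by simp
      then have "p r < p (p c)"
        using E[of r "p c"] True inv_on_invol[OF i, of c] ce by simp
      moreover have "p r \<ge> c" using R r by auto
      ultimately show False using inv_on_invol[OF i, of c] by simp
    qed
    then have pr: "p r = c" using inv_on_invol[OF i, of c] by simp
    have S: "p ` {r, c} \<subseteq> {r, c}" using pc pr by simp
    note i' = i[folded un]
    define T where "T = R - {r} \<union> {} \<union> {Suc c..<e}"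
    define q where "q = restr T p"
    have qx: "q x = (if x = r \<or> x = c then x else p x)" for x
      using inv_on_outside[OF i, of x] disj by (auto simp: q_def T_def restr_def)
    have "q \<in> queue_invs (R - {r}) {} {Suc c..<e}"
      unfolding queue_invs_def
    proof (intro CollectI conjI allI impI ballI)
      show "inv_on (R - {r} \<union> {} \<union> {Suc c..<e}) q"
        unfolding q_def T_def by (rule inv_on_restr[OF i image_complement_inv_on[OF i' S disj]])
      show "q ` (R - {r}) \<subseteq> {Suc c..<e}"
      proof
        fix y assume "y \<in> q ` (R - {r})"
        then obtain x where x: "x \<in> R" "x \<noteq> r" "y = p x"
          using lt by (auto simp: qx)
        have "p x \<in> {c..<e}" using R x by auto
        moreover have "p x \<noteq> c"
          using x pr inv_on_eq_iff[OF i, of x r] by auto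
        ultimately show "y \<in> {Suc c..<e}" using x by auto
      qed
      show "avoids_132_on {} (q)" by (simp add: avoids_132_on_def)
    next
      fix i j assume "i < j" "j \<le> q j" "q j \<in> {Suc c..<e}"
      then show "q i < q j"
        using E[of i j] r by (auto simp: qx split: if_splits)
    next
      fix z assume z: "z \<in> {Suc c..<e}"
      then obtain i where "i < z" "z \<le> p i" using cn[of z] by auto
      then show "\<exists>i<z. z \<le> q i"
        using z pc pr r by (intro exI[of _ i]) (auto simp: qx)
    qed
    then show ?thesis
      unfolding q_def T_def by (intro UnI1 glue_restr[OF i' S disj] restr_arc[OF i pr])
  next
    case False
    have nf: "p c \<noteq> c" using queue_no_fixed[OF p, of c] ce by auto
    have i: "inv_on (R \<union> {} \<union> {c..<e}) p" by (rule queue_invsD(1)[OF p])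
    have Rc: "p x \<in> {Suc c..<e}" if "x \<in> R" for x
    proof -
      have "p x \<noteq> c" using False that lt inv_on_invol[OF i, of x] by auto
      with queue_invsD(2)[OF p that] show ?thesis by auto
    qed
    have "p c \<in> {Suc c..<e}"
      using inv_on_mem[OF i, of c] False nf ce lt by auto
    then have 1: "p ` insert c R \<subseteq> {Suc c..<e}" using Rc by auto
    have 2: "insert c R \<union> {} \<union> {Suc c..<e} = R \<union> {} \<union> {c..<e}" using ce by auto
    have "p \<in> ?O"
      unfolding queue_invs_def 2
    proof (intro CollectI conjI allI impI ballI 1)
      show "p i < p j" if "i < j" "j \<le> p j" "p j \<in> {Suc c..<e}" for i j
        using queue_invsD(4)[OF p that(1,2)] that(3) by auto
    qed (use queue_invsD[OF p] in auto)
    then show ?thesis by simp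
  qed
  have 2: "p \<in> ?L" if p: "p \<in> ?G" for p
  proof -
    obtain s q where s: "s \<in> arc r c" and q: "q \<in> queue_invs (R - {r}) {} {Suc c..<e}"
      and i1: "inv_on {r, c} s" and iq: "inv_on (R - {r} \<union> {} \<union> {Suc c..<e}) q"
      and ip: "inv_on ({r, c} \<union> (R - {r} \<union> {} \<union> {Suc c..<e})) p"
      and px: "\<And>x. p x = (if x \<in> {r, c} then s x else q x)"
      by (rule glueE[OF p arc_inv_on queue_invs_subset disj]) blast
    have pr: "p r = c" "p c = r" using arcD[OF s] by (auto simp: px)
    have pq: "p x = q x" if "x \<noteq> r" "x \<noteq> c" for x using that by (simp add: px)
    have qq: "q r = r" "q c = c" using inv_on_outside[OF iq, of r] inv_on_outside[OF iq, of c] disj by auto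
    have R: "q ` (R - {r}) \<subseteq> {Suc c..<e}" and E: "\<And>i j. i < j \<Longrightarrow> j \<le> q j \<Longrightarrow> q j \<in> {Suc c..<e} \<Longrightarrow> q i < q j"
      and cn: "\<And>z. z \<in> {Suc c..<e} \<Longrightarrow> \<exists>i<z. z \<le> q i"
      using queue_invsD[OF q] by blast+
    show ?thesis
      unfolding queue_invs_def
    proof (intro CollectI conjI allI impI ballI)
      show "inv_on (R \<union> {} \<union> {c..<e}) p" using ip by (simp only: un)
      show "p ` R \<subseteq> {c..<e}"
      proof
        fix y assume "y \<in> p ` R"
        then obtain x where x: "x \<in> R" "y = p x" by auto
        show "y \<in> {c..<e}"
        proof (cases "x = r")
          case True then show ?thesis using x pr ce by simp
        next
          case False
          then have "q x \<in> {Suc c..<e}" using R x by auto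
          then show ?thesis using x pq[of x] False lt by auto
        qed
      qed
      show "avoids_132_on {} p" by (simp add: avoids_132_on_def)
    next
      fix i j assume ij: "i < j" "j \<le> p j" "p j \<in> {c..<e}"
      have "j \<noteq> c" using ij pr r by auto
      show "p i < p j"
      proof (cases "j = r")
        case True
        \<comment> \<open>Nothing in the support precedes \<open>Min R\<close>, so such an
          \<open>i\<close> is fixed.\<close>
        then have "i \<notin> R \<union> {} \<union> {c..<e}"
          using r(2)[of i] r(3) ij by auto
        then have "p i = i" using ip unfolding un by (intro inv_on_outside)
        then show ?thesis using ij by simp
      next
        case False
        have "p j \<noteq> c" using False pr inv_on_eq_iff[OF ip, of j r] by auto
        then have "q i < q j" "q j > c"
          using E[of i j] ij pq[of j] \<open>j \<noteq> c\<close> False by auto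
        then show ?thesis
          using pr pq[of i] pq[of j] \<open>j \<noteq> c\<close> False r by (cases "i = r"; cases "i = c") auto
      qed
    next
      fix z assume z: "z \<in> {c..<e}"
      show "\<exists>i<z. z \<le> p i"
      proof (cases "z = c")
        case True then show ?thesis using pr r by auto
      next
        case False
        then obtain i where i: "i < z" "z \<le> q i" using cn[of z] z by auto
        then have "i \<noteq> r" "i \<noteq> c" using qq by auto
        with i show ?thesis using pq[of i] by auto
      qed
    qed
  qed
  have 3: "p \<in> ?L" if p: "p \<in> ?O" for p
  proof -
    have "insert c R \<union> {} \<union> {Suc c..<e} = R \<union> {} \<union> {c..<e}" using ce by auto
    then have ip: "inv_on (R \<union> {} \<union> {c..<e}) p" using queue_invsD(1)[OF p] by simp
    have pc: "p c \<in> {Suc c..<e}" and R: "p ` R \<subseteq> {Suc c..<e}"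
      using queue_invsD(2)[OF p] by auto
    have E: "\<And>i j. i < j \<Longrightarrow> j \<le> p j \<Longrightarrow> p j \<in> {Suc c..<e} \<Longrightarrow> p i < p j"
      and cn: "\<And>z. z \<in> {Suc c..<e} \<Longrightarrow> \<exists>i<z. z \<le> p i"
      using queue_invsD[OF p] by blast+
    show ?thesis
      unfolding queue_invs_def
    proof (intro CollectI conjI allI impI ballI)
      show "p ` R \<subseteq> {c..<e}" using R by auto
      show "avoids_132_on {} p" by (simp add: avoids_132_on_def)
    next
      fix i j assume ij: "i < j" "j \<le> p j" "p j \<in> {c..<e}"
      have "p j \<noteq> c" using ij pc inv_on_invol[OF ip, of j] by auto
      then show "p i < p j" using E[of i j] ij by auto
    next
      fix z assume z: "z \<in> {c..<e}"
      show "\<exists>i<z. z \<le> p i"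
      proof (cases "z = c")
        case True
        have "p r \<in> {Suc c..<e}" using R r by auto
        with True r show ?thesis by (intro exI[of _ r]) auto
      qed (use cn[of z] z in auto)
    qed (rule ip)
  qed
  show ?thesis
    using 1 2 3 by blast
qed

section \<open>Points at the two ends of the middle interval that enter the queue\<close>

lemma glue_subset:
  assumes "P \<subseteq> {p. inv_on S p}" "Q \<subseteq> {p. inv_on T p}" "S \<inter> T = {}"
  shows "glue P Q \<subseteq> {p. inv_on (S \<union> T) p}"
  using glueE[OF _ assms] by blast

lemma queue_invsI:
  assumes "inv_on (R \<union> M \<union> Z) p" "\<And>x. x \<in> R \<Longrightarrow> p x \<in> Z" "avoids_132_on M p"
    "\<And>i j. i < j \<Longrightarrow> j \<le> p j \<Longrightarrow> p j \<in> Z \<Longrightarrow> p i < p j"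
    "\<And>z. z \<in> Z \<Longrightarrow> \<exists>i<z. z \<le> p i"
  shows "p \<in> queue_invs R M Z"
  using assms unfolding queue_invs_def by blast

lemma avoids_132_onD:
  "avoids_132_on M p \<Longrightarrow> i \<in> M \<Longrightarrow> j \<in> M \<Longrightarrow> k \<in> M \<Longrightarrow> i < j \<Longrightarrow> j < k \<Longrightarrow> p i < p k \<Longrightarrow> p j \<le> p k"
  unfolding avoids_132_on_def by blast

lemma avoids_132_on_mono: "avoids_132_on M p \<Longrightarrow> N \<subseteq> M \<Longrightarrow> avoids_132_on N p"
  unfolding avoids_132_on_def by blast

lemma avoids_132_on_cong: "avoids_132_on M p \<Longrightarrow> (\<And>x. x \<in> M \<Longrightarrow> q x = p x) \<Longrightarrow> avoids_132_on M q"
  unfolding avoids_132_on_def by simp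

lemma avoids_132_on_empty [simp]: "avoids_132_on {} p"
  by (simp add: avoids_132_on_def)

text \<open>Moving \<open>a\<close> from the middle to \<open>R\<close> loses no 132-condition. If
  \<open>a\<close> plays the role of 1, the last entry of the triple has a value above
  \<open>p a\<close>, hence in \<open>Z\<close>; it is an opener too, and non-nesting already bounds
  the middle entry.\<close>

lemma queue_invs_min_opener:
  assumes lt: "\<And>x z. x \<in> R \<union> {a..<b} \<Longrightarrow> z \<in> Z \<Longrightarrow> x < z" and ab: "a < b"
  shows "{p \<in> queue_invs R {a..<b} Z. p a \<in> Z} = queue_invs (insert a R) {Suc a..<b} Z" (is "?L = ?Q")
proof -
  have un: "insert a R \<union> {Suc a..<b} \<union> Z = R \<union> {a..<b} \<union> Z"
    using ab by auto
  have "p \<in> ?Q" if p: "p \<in> ?L" for p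
  proof (rule queue_invsI)
    have p': "p \<in> queue_invs R {a..<b} Z" using p by simp
    show "inv_on (insert a R \<union> {Suc a..<b} \<union> Z) p"
      unfolding un by (rule queue_invsD(1)[OF p'])
    show "x \<in> insert a R \<Longrightarrow> p x \<in> Z" for x
      using p queue_invsD(2)[OF p', of x] by blast
    show "avoids_132_on {Suc a..<b} p"
      by (rule avoids_132_on_mono[OF queue_invsD(3)[OF p']]) auto
  qed (use p queue_invsD[of p R "{a..<b}" Z] in blast)+
  moreover have "p \<in> ?L" if p: "p \<in> ?Q" for p
  proof -
    have ip: "inv_on (R \<union> {a..<b} \<union> Z) p"
      using queue_invsD(1)[OF p] by (simp only: un)
    have pa: "p a \<in> Z" using queue_invsD(2)[OF p, of a] by simp
    \<comment> \<open>\<open>Z\<close> lies above the rest of the support, so a value exceeding an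
      element of \<open>Z\<close> is itself in \<open>Z\<close>.\<close>
    have big: "p k \<in> Z" if "k \<in> {a..<b}" "z < p k" "z \<in> Z" for k z
      using inv_on_mem[OF ip, of k] lt[of "p k" z] that by auto
    have "p \<in> queue_invs R {a..<b} Z"
    proof (rule queue_invsI[OF ip])
      show "avoids_132_on {a..<b} p"
        unfolding avoids_132_on_def
      proof (intro ballI impI, rule ccontr)
        fix i j k assume m: "i \<in> {a..<b}" "j \<in> {a..<b}" "k \<in> {a..<b}"
          and o: "i < j" "j < k" "p i < p k" "\<not> p j \<le> p k"
        show False
        proof (cases "i = a")
          case True
          have "p k \<in> Z" using big[OF m(3), of "p a"] o pa True by simp
          moreover have "k \<le> p k" using lt[of k "p k"] m \<open>p k \<in> Z\<close> by auto
          ultimately have "p j < p k" by (rule queue_invsD(4)[OF p o(2), rotated])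
          with o show False by simp
        next
          case False
          with m o have "p j \<le> p k"
            by (intro avoids_132_onD[OF queue_invsD(3)[OF p], of i]) auto
          with o show False by simp
        qed
      qed
    qed (use queue_invsD[OF p] in blast)+
    with pa show ?thesis by simp
  qed
  ultimately show ?thesis by blast
qed

text \<open>Here the moved point \<open>d\<close> can only be the last entry of a 132, and
  non-nesting makes every earlier value smaller than \<open>p d\<close>.\<close>

lemma queue_invs_max_opener:
  assumes lt: "\<And>x z. x \<in> R \<union> {a..<Suc d} \<Longrightarrow> z \<in> Z \<Longrightarrow> x < z" and ad: "a \<le> d"
  shows "{p \<in> queue_invs R {a..<Suc d} Z. p d \<in> Z} = queue_invs (insert d R) {a..<d} Z" (is "?L = ?Q")
proof -
  have un: "insert d R \<union> {a..<d} \<union> Z = R \<union> {a..<Suc d} \<union> Z"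
    using ad by auto
  have "p \<in> ?Q" if p: "p \<in> ?L" for p
  proof (rule queue_invsI)
    have p': "p \<in> queue_invs R {a..<Suc d} Z" using p by simp
    show "inv_on (insert d R \<union> {a..<d} \<union> Z) p"
      unfolding un by (rule queue_invsD(1)[OF p'])
    show "x \<in> insert d R \<Longrightarrow> p x \<in> Z" for x
      using p queue_invsD(2)[OF p', of x] by blast
    show "avoids_132_on {a..<d} p"
      by (rule avoids_132_on_mono[OF queue_invsD(3)[OF p']]) auto
  qed (use p queue_invsD[of p R "{a..<Suc d}" Z] in blast)+
  moreover have "p \<in> ?L" if p: "p \<in> ?Q" for p
  proof -
    have ip: "inv_on (R \<union> {a..<Suc d} \<union> Z) p"
      using queue_invsD(1)[OF p] by (simp only: un)
    have pd: "p d \<in> Z" using queue_invsD(2)[OF p, of d] by simp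
    have "p \<in> queue_invs R {a..<Suc d} Z"
    proof (rule queue_invsI[OF ip])
      show "avoids_132_on {a..<Suc d} p"
        unfolding avoids_132_on_def
      proof (intro ballI impI)
        fix i j k assume m: "i \<in> {a..<Suc d}" "j \<in> {a..<Suc d}" "k \<in> {a..<Suc d}"
          and o: "i < j" "j < k" "p i < p k"
        show "p j \<le> p k"
        proof (cases "k = d")
          case True
          have "p j < p k"
            by (rule queue_invsD(4)[OF p o(2)]) (use pd lt[of d "p d"] ad True in auto)
          then show ?thesis by simp
        next
          case False
          with m o show "p j \<le> p k"
            by (intro avoids_132_onD[OF queue_invsD(3)[OF p], of i]) auto
        qed
      qed
    qed (use queue_invsD[OF p] in blast)+
    with pd show ?thesis by simp
  qed
  ultimately show ?thesis by blast
qed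

section \<open>Pairs of exchanged intervals and the Catalan recursion\<close>

lemma upward_closed_eq:
  fixes S :: "nat set"
  assumes "S \<subseteq> {a..<b}" "\<And>x y. x \<in> S \<Longrightarrow> x < y \<Longrightarrow> y < b \<Longrightarrow> y \<in> S"
  shows "S = {b - card S..<b}"
proof (cases "S = {}")
  case False
  define m where "m = Min S"
  have fin: "finite S" using assms(1) finite_subset by blast
  have m: "m \<in> S" "\<And>x. x \<in> S \<Longrightarrow> m \<le> x" using fin False by (auto simp: m_def)
  have "S = {m..<b}"
  proof (intro equalityI subsetI)
    fix x assume "x \<in> {m..<b}"
    then show "x \<in> S" using m(1) assms(2)[of m x] by (cases "x = m") auto
  qed (use m assms(1) in auto)
  moreover from this have "b - card S = m" using m(1) assms(1) by auto
  ultimately show ?thesis by simp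
qed simp

text \<open>A 132-avoiding bijection from the first interval onto the second, coded together with
  its inverse as a single involution. These are the possible outer layers of the middle
  part.\<close>

definition swap_invs :: "nat \<Rightarrow> nat \<Rightarrow> nat \<Rightarrow> (nat \<Rightarrow> nat) set" where
  "swap_invs a b n = {p. inv_on ({a..<a + n} \<union> {b..<b + n}) p \<and>
     p ` {a..<a + n} \<subseteq> {b..<b + n} \<and> avoids_132_on {a..<a + n} p}"

lemma swap_invs_subset: "swap_invs a b n \<subseteq> {p. inv_on ({a..<a + n} \<union> {b..<b + n}) p}"
  unfolding swap_invs_def by blast

lemma swap_invsD:
  assumes "p \<in> swap_invs a b n"
  shows "inv_on ({a..<a + n} \<union> {b..<b + n}) p" "x \<in> {a..<a + n} \<Longrightarrow> p x \<in> {b..<b + n}"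
    "avoids_132_on {a..<a + n} p"
  using assms unfolding swap_invs_def by blast+

lemma swap_invs_image:
  assumes p: "p \<in> swap_invs a b n"
  shows "p ` {a..<a + n} = {b..<b + n}"
proof (rule card_subset_eq)
  show "p ` {a..<a + n} \<subseteq> {b..<b + n}" using swap_invsD(2)[OF p] by blast
  have "inj_on p {a..<a + n}"
    by (rule inj_onI) (use inv_on_eq_iff[OF swap_invsD(1)[OF p]] in blast)
  then show "card (p ` {a..<a + n}) = card {b..<b + n}" by (simp add: card_image)
qed simp

lemma swap_invs_inverse:
  assumes p: "p \<in> swap_invs a b n" and y: "y \<in> {b..<b + n}"
  shows "p y \<in> {a..<a + n}"
proof -
  obtain x where "x \<in> {a..<a + n}" "y = p x"
    using y swap_invs_image[OF p] by blast
  then show ?thesis using inv_on_invol[OF swap_invsD(1)[OF p], of x] by simp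
qed

text \<open>The permutation 132 is its own inverse, so imposing avoidance on one of the two
  intervals is enough.\<close>

lemma swap_invs_avoids_inverse:
  assumes p: "p \<in> swap_invs a b n"
  shows "avoids_132_on {b..<b + n} p"
  unfolding avoids_132_on_def
proof (intro ballI impI, rule ccontr)
  fix i j k assume m: "i \<in> {b..<b + n}" "j \<in> {b..<b + n}" "k \<in> {b..<b + n}"
    and o: "i < j" "j < k" "p i < p k" "\<not> p j \<le> p k"
  note [simp] = inv_on_invol[OF swap_invsD(1)[OF p]]
  have "p (p k) \<le> p (p j)"
    by (rule avoids_132_onD[OF swap_invsD(3)[OF p], of "p i" "p k" "p j"])
      (use m o swap_invs_inverse[OF p] in \<open>simp_all del: atLeastLessThan_iff\<close>)
  with o show False by simp
qed

lemma swap_invs_0: "swap_invs a b 0 = {id}"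
proof -
  have "p = id" if "p \<in> swap_invs a b 0" for p
    using inv_on_outside[OF swap_invsD(1)[OF that]] by (intro ext) simp
  moreover have "id \<in> swap_invs a b 0"
    by (simp add: swap_invs_def inv_on_def)
  ultimately show ?thesis by blast
qed

text \<open>The Catalan decomposition at the position \<open>a + i\<close> of the largest value
  \<open>b + n\<close>: avoiding 132 forces all values to its left above all values to its right. So
  the left block takes the top \<open>i\<close> values and the right block the remaining
  ones.\<close>

lemma swap_invs_step:
  assumes ab: "a + Suc n \<le> b" and i: "i \<le> n"
  shows "{p \<in> swap_invs a b (Suc n). p (b + n) = a + i} =
    glue (arc (a + i) (b + n)) (glue (swap_invs a (b + (n - i)) i) (swap_invs (Suc (a + i)) b (n - i)))"
    (is "?L = ?G")
proof -
  define S where "S = {a + i, b + n}"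
  define A1 where "A1 = {a..<a + i}"
  define A2 where "A2 = {Suc (a + i)..<Suc (a + i) + (n - i)}"
  define B1 where "B1 = {b + (n - i)..<b + (n - i) + i}"
  define B2 where "B2 = {b..<b + (n - i)}"
  note defs = S_def A1_def A2_def B1_def B2_def
  have d1: "S \<inter> ((A1 \<union> B1) \<union> (A2 \<union> B2)) = {}" and d2: "(A1 \<union> B1) \<inter> (A2 \<union> B2) = {}"
    using ab i by (auto simp: defs)
  have A: "{a..<a + Suc n} = A1 \<union> {a + i} \<union> A2" and B: "{b..<b + Suc n} = B1 \<union> {b + n} \<union> B2"
    using i by (auto simp: defs)
  have un: "{a..<a + Suc n} \<union> {b..<b + Suc n} = S \<union> ((A1 \<union> B1) \<union> (A2 \<union> B2))"
    unfolding A B by (auto simp: S_def)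
  have I1: "swap_invs a (b + (n - i)) i \<subseteq> {p. inv_on (A1 \<union> B1) p}"
    and I2: "swap_invs (Suc (a + i)) b (n - i) \<subseteq> {p. inv_on (A2 \<union> B2) p}"
    unfolding defs by (rule swap_invs_subset)+
  have "p \<in> ?G" if p: "p \<in> ?L" for p
  proof -
    have p': "p \<in> swap_invs a b (Suc n)" and pd: "p (b + n) = a + i" using p by auto
    note ip = swap_invsD(1)[OF p']
    have pc: "p (a + i) = b + n" using inv_on_invol[OF ip, of "b + n"] pd by simp
    have v: "p x \<in> {b..<b + n}" if "x \<in> A1 \<union> A2" for x
    proof -
      have "x \<in> {a..<a + Suc n}" "x \<noteq> a + i" using that A by (auto simp: defs)
      then show ?thesis
        using swap_invsD(2)[OF p', of x] inv_on_eq_iff[OF ip, of x "a + i"] pc by auto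
    qed
    \<comment> \<open>Otherwise \<open>x\<close>, \<open>a + i\<close>, \<open>y\<close> is a 132
      with the maximum in the middle.\<close>
    have sep: "p y < p x" if xy: "x \<in> A1" "y \<in> A2" for x y
    proof (rule ccontr)
      assume "\<not> p y < p x"
      then have "p x < p y"
        using inv_on_eq_iff[OF ip, of x y] xy by (auto simp: defs)
      then have "p (a + i) \<le> p y"
        by (intro avoids_132_onD[OF swap_invsD(3)[OF p'], of x])
          (use xy i in \<open>auto simp: defs\<close>)
      with pc v[of y] xy show False by simp
    qed
    have inj: "inj_on p X" for X
      by (rule inj_onI) (use inv_on_eq_iff[OF ip] in blast)
    have onto: "y \<in> p ` A1 \<union> p ` A2" if "y \<in> {b..<b + n}" for y
    proof -
      have "y \<in> p ` {a..<a + Suc n}" using swap_invs_image[OF p'] that by auto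
      with pc that show ?thesis unfolding A by auto
    qed
    \<comment> \<open>By \<open>sep\<close> the image is closed upwards, so its cardinality alone
      determines it.\<close>
    have "p ` A1 = {b + n - card (p ` A1)..<b + n}"
    proof (rule upward_closed_eq)
      show "p ` A1 \<subseteq> {b..<b + n}" using v by blast
      fix x y assume x: "x \<in> p ` A1" and y: "x < y" "y < b + n"
      have "x \<ge> b" using x v by auto
      with y have "y \<in> p ` A1 \<union> p ` A2" by (intro onto) auto
      moreover have "y \<notin> p ` A2" using sep x y by (auto dest: order.asym)
      ultimately show "y \<in> p ` A1" by blast
    qed
    also have "card (p ` A1) = i" using card_image[OF inj] by (simp add: A1_def)
    finally have im1: "p ` A1 = B1" using i by (auto simp: B1_def)
    have im2: "p ` A2 \<subseteq> B2"
    proof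
      fix y assume "y \<in> p ` A2"
      then obtain x where x: "x \<in> A2" "y = p x" by blast
      have "y \<notin> p ` A1" using x sep[OF _ x(1)] by (metis imageE less_irrefl)
      moreover have "y \<in> {b..<b + n}" using v x by blast
      ultimately show "y \<in> B2" unfolding im1 by (auto simp: B1_def B2_def)
    qed
    note ip' = ip[unfolded un]
    have S: "p ` S \<subseteq> S" using pc pd by (auto simp: S_def)
    have pp: "p (p x) = x" for x by (rule inv_on_invol[OF ip])
    have S1: "p ` (A1 \<union> B1) \<subseteq> A1 \<union> B1"
      unfolding im1[symmetric] by (auto simp: pp)
    let ?T = "(A1 \<union> B1) \<union> (A2 \<union> B2)"
    have T: "p ` ?T \<subseteq> ?T" by (rule image_complement_inv_on[OF ip' S d1])
    have it: "inv_on ?T (restr ?T p)" by (rule inv_on_restr[OF ip T])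
    have r1: "restr (A1 \<union> B1) (restr ?T p) = restr (A1 \<union> B1) p"
      and r2: "restr (A2 \<union> B2) (restr ?T p) = restr (A2 \<union> B2) p"
      by (auto simp: restr_def fun_eq_iff)
    have S1': "restr ?T p ` (A1 \<union> B1) \<subseteq> A1 \<union> B1"
      using S1 by (auto simp: restr_def)
    have S2': "restr ?T p ` (A2 \<union> B2) \<subseteq> A2 \<union> B2"
      by (rule image_complement_inv_on[OF it S1' d2])
    then have S2: "p ` (A2 \<union> B2) \<subseteq> A2 \<union> B2"
      by (auto simp: restr_def)
    have "restr (A1 \<union> B1) p \<in> swap_invs a (b + (n - i)) i"
      unfolding swap_invs_def A1_def[symmetric] B1_def[symmetric]
    proof (intro CollectI conjI)
      show "inv_on (A1 \<union> B1) (restr (A1 \<union> B1) p)" by (rule inv_on_restr[OF ip S1])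
      show "restr (A1 \<union> B1) p ` A1 \<subseteq> B1" using im1 by (auto simp: restr_def)
      show "avoids_132_on A1 (restr (A1 \<union> B1) p)"
        by (rule avoids_132_on_cong[OF avoids_132_on_mono[OF swap_invsD(3)[OF p']]])
          (use i in \<open>auto simp: A1_def A2_def restr_def\<close>)
    qed
    moreover have "restr (A2 \<union> B2) p \<in> swap_invs (Suc (a + i)) b (n - i)"
      unfolding swap_invs_def A2_def[symmetric] B2_def[symmetric]
    proof (intro CollectI conjI)
      show "inv_on (A2 \<union> B2) (restr (A2 \<union> B2) p)" by (rule inv_on_restr[OF ip S2])
      show "restr (A2 \<union> B2) p ` A2 \<subseteq> B2" using im2 by (auto simp: restr_def)
      show "avoids_132_on A2 (restr (A2 \<union> B2) p)"
        by (rule avoids_132_on_cong[OF avoids_132_on_mono[OF swap_invsD(3)[OF p']]])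
          (use i in \<open>auto simp: A1_def A2_def restr_def\<close>)
    qed
    ultimately have "restr ?T p \<in> glue (swap_invs a (b + (n - i)) i) (swap_invs (Suc (a + i)) b (n - i))"
      by (intro glue_restr[OF it S1' d2]) (simp_all only: r1 r2)
    then show ?thesis
      by (intro glue_restr[OF ip' S d1]) (simp add: S_def restr_arc[OF ip pc])
  qed
  moreover have "p \<in> ?L" if p: "p \<in> ?G" for p
  proof -
    obtain s r where s: "s \<in> arc (a + i) (b + n)"
      and r: "r \<in> glue (swap_invs a (b + (n - i)) i) (swap_invs (Suc (a + i)) b (n - i))"
      and ip: "inv_on (S \<union> ((A1 \<union> B1) \<union> (A2 \<union> B2))) p"
      and ps: "\<And>x. p x = (if x \<in> S then s x else r x)"
      by (rule glueE[OF p arc_inv_on[of "a + i" "b + n", folded S_def] glue_subset[OF I1 I2 d2] d1]) blast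
    obtain f g where f: "f \<in> swap_invs a (b + (n - i)) i" and g: "g \<in> swap_invs (Suc (a + i)) b (n - i)"
      and rf: "\<And>x. r x = (if x \<in> A1 \<union> B1 then f x else g x)"
      by (rule glueE[OF r I1 I2 d2]) blast
    have pc: "p (a + i) = b + n" "p (b + n) = a + i"
      using arcD[OF s] by (auto simp: ps S_def)
    have p1: "p x = f x" "p x \<in> B1" if "x \<in> A1" for x
    proof -
      show "p x = f x" using that d1 by (auto simp: ps rf)
      then show "p x \<in> B1" using swap_invsD(2)[OF f, of x] that by (simp only: A1_def B1_def)
    qed
    have p2: "p x = g x" "p x \<in> B2" if "x \<in> A2" for x
    proof -
      show "p x = g x" using that d1 d2 by (auto simp: ps rf)
      then show "p x \<in> B2" using swap_invsD(2)[OF g, of x] that by (simp only: A2_def B2_def)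
    qed
    have "avoids_132_on {a..<a + Suc n} p"
      unfolding avoids_132_on_def
    proof (intro ballI impI)
      fix x y z assume m: "x \<in> {a..<a + Suc n}" "y \<in> {a..<a + Suc n}" "z \<in> {a..<a + Suc n}"
        and o: "x < y" "y < z" "p x < p z"
      consider "z \<in> A1" | "z = a + i" | "z \<in> A2" using m(3) unfolding A by blast
      then show "p y \<le> p z"
      proof cases
        case 1
        then have "x \<in> A1" "y \<in> A1" using m o by (auto simp: A1_def)
        then show ?thesis
          using avoids_132_onD[OF swap_invsD(3)[OF f, folded A1_def], of x y z] 1 o p1(1) by simp
      next
        case 2
        then have "y \<in> A1" using m o by (auto simp: A1_def)
        then show ?thesis using p1(2)[of y] pc 2 i by (auto simp: B1_def)
      next
        case 3
        have "x \<notin> A1" using p1(2)[of x] p2(2)[OF 3] o by (auto simp: B1_def B2_def)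
        moreover have "x \<noteq> a + i" using pc p2(2)[OF 3] o by (auto simp: B2_def)
        ultimately have "x \<in> A2" using m unfolding A by blast
        moreover have "y \<in> A2" using \<open>x \<in> A2\<close> o 3 by (auto simp: A2_def)
        ultimately show ?thesis
          using avoids_132_onD[OF swap_invsD(3)[OF g, folded A2_def], of x y z] 3 o p2(1) by simp
      qed
    qed
    moreover have "p ` {a..<a + Suc n} \<subseteq> {b..<b + Suc n}"
      unfolding A B using p1 p2 pc by auto
    ultimately show ?thesis
      using ip pc by (simp only: swap_invs_def un mem_Collect_eq simp_thms)
  qed
  ultimately show ?thesis by blast
qed

section \<open>Outer layers of the middle interval\<close>

lemma inv_on_subset_fixed:
  "inv_on S p \<Longrightarrow> (\<And>x. x \<in> S - T \<Longrightarrow> p x = x) \<Longrightarrow> inv_on T p"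
  unfolding inv_on_def by blast

text \<open>The condition at risk is the last one: the arc passing over \<open>z\<close> might be
  deleted. But deleted points are matched among themselves inside \<open>M\<close>, which lies
  before \<open>Z\<close>, so no deleted arc reaches \<open>z\<close>.\<close>

lemma queue_invs_restr:
  assumes p: "p \<in> queue_invs R M Z" and N: "N \<subseteq> M"
    and im: "p ` (R \<union> N \<union> Z) \<subseteq> R \<union> N \<union> Z"
    and lt: "\<And>x z. x \<in> M \<Longrightarrow> z \<in> Z \<Longrightarrow> x < z"
  shows "restr (R \<union> N \<union> Z) p \<in> queue_invs R N Z"
proof (rule queue_invsI)
  note ip = queue_invsD(1)[OF p]
  show "inv_on (R \<union> N \<union> Z) (restr (R \<union> N \<union> Z) p)"
    by (rule inv_on_restr[OF ip im])
  show "restr (R \<union> N \<union> Z) p x \<in> Z" if "x \<in> R" for x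
    using queue_invsD(2)[OF p that] that by (simp add: restr_def)
  show "avoids_132_on N (restr (R \<union> N \<union> Z) p)"
    by (rule avoids_132_on_cong[OF avoids_132_on_mono[OF queue_invsD(3)[OF p] N]])
      (auto simp: restr_def)
  show "restr (R \<union> N \<union> Z) p i < restr (R \<union> N \<union> Z) p j"
    if "i < j" "j \<le> restr (R \<union> N \<union> Z) p j" "restr (R \<union> N \<union> Z) p j \<in> Z" for i j
  proof -
    have "restr (R \<union> N \<union> Z) p j = p j" using that(3) by (auto simp: restr_def split: if_splits)
    then show ?thesis
      using queue_invsD(4)[OF p that(1)] that by (auto simp: restr_def)
  qed
  show "\<exists>i<z. z \<le> restr (R \<union> N \<union> Z) p i" if z: "z \<in> Z" for z
  proof -
    obtain i where i: "i < z" "z \<le> p i" using queue_invsD(5)[OF p z] by blast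
    have "i \<in> R \<union> N \<union> Z"
    proof (rule ccontr)
      assume n: "i \<notin> R \<union> N \<union> Z"
      have "i \<in> M" using inv_on_outside[OF ip, of i] n i by auto
      then have "p i \<in> R \<union> M \<union> Z" using inv_on_mem[OF ip, of i] by blast
      moreover have "p i \<notin> M" using i lt[of "p i" z] z by auto
      ultimately have "p i \<in> R \<union> N \<union> Z" by blast
      then have "p (p i) \<in> R \<union> N \<union> Z" using im by blast
      then show False using n inv_on_invol[OF ip, of i] by simp
    qed
    then show ?thesis using i by (auto simp: restr_def)
  qed
qed

text \<open>A fixed last point stops the whole middle from entering the queue, so the middle becomes
  a free 132-avoiding involution and \<open>R\<close> is served by \<open>Z\<close> independently of
  it.\<close>

lemma queue_invs_max_fixed:
  assumes lt: "\<And>x z. x \<in> R \<union> {a..<Suc d} \<Longrightarrow> z \<in> Z \<Longrightarrow> x < z" and ad: "a \<le> d"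
    and disj: "R \<inter> {a..<Suc d} = {}"
  shows "{p \<in> queue_invs R {a..<Suc d} Z. p a \<notin> Z \<and> p d = d} =
    glue (queue_invs {} {a..<d} {}) (queue_invs R {} Z)" (is "?L = ?G")
proof -
  define S where "S = {} \<union> {a..<d} \<union> ({} :: nat set)"
  define T where "T = R \<union> {} \<union> Z"
  have dis: "S \<inter> T = {}" using disj lt[of "_ :: nat"] by (fastforce simp: S_def T_def)
  have dnot: "d \<notin> S \<union> T" using disj lt[of d d] ad by (auto simp: S_def T_def)
  have un: "R \<union> {a..<Suc d} \<union> Z = insert d (S \<union> T)"
    using ad by (auto simp: S_def T_def)
  have "p \<in> ?G" if p: "p \<in> ?L" for p
  proof -
    have p': "p \<in> queue_invs R {a..<Suc d} Z" and pa: "p a \<notin> Z" and pd: "p d = d" using p by auto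
    note ip = queue_invsD(1)[OF p']
    have ip': "inv_on (S \<union> T) p"
      by (rule inv_on_subset_fixed[OF ip[unfolded un]]) (use pd in auto)
    have notR: "p x \<notin> R" if "x \<notin> Z" for x
      using queue_invsD(2)[OF p', of "p x"] that inv_on_invol[OF ip, of x] by auto
    have S: "p ` S \<subseteq> S"
    proof
      fix y assume "y \<in> p ` S"
      then obtain x where x: "x \<in> {a..<d}" "y = p x" by (auto simp: S_def)
      have xd: "p x \<noteq> d" using inv_on_eq_iff[OF ip, of x d] pd x by auto
      have "x \<notin> Z" using lt[of x x] x by auto
      \<comment> \<open>Otherwise \<open>a\<close>, \<open>x\<close>, \<open>d\<close> is a 132,
        because \<open>p a < d = p d < p x\<close>.\<close>
      have "p x \<notin> Z"
      proof
        assume z: "p x \<in> Z"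
        then have "a < x" using pa x by (cases "x = a") auto
        have "p a \<noteq> d" using inv_on_eq_iff[OF ip, of a d] pd x by auto
        moreover have "a \<notin> Z" using lt[of a a] ad by auto
        ultimately have "p a < p d"
          using inv_on_mem[OF ip, of a] pa notR[of a] ad pd by auto
        then have "p x \<le> p d"
          by (intro avoids_132_onD[OF queue_invsD(3)[OF p'], of a]) (use x \<open>a < x\<close> in auto)
        with z lt[of d "p x"] pd ad show False by auto
      qed
      then show "y \<in> S"
        using inv_on_mem[OF ip, of x] notR[OF \<open>x \<notin> Z\<close>] x xd by (auto simp: S_def)
    qed
    have T: "p ` T \<subseteq> T" by (rule image_complement_inv_on[OF ip' S dis])
    have "restr S p \<in> queue_invs {} {a..<d} {}"
    proof (rule queue_invsI)
      show "inv_on ({} \<union> {a..<d} \<union> {}) (restr S p)"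
        unfolding S_def[symmetric] by (rule inv_on_restr[OF ip' S])
      show "avoids_132_on {a..<d} (restr S p)"
        by (rule avoids_132_on_cong[OF avoids_132_on_mono[OF queue_invsD(3)[OF p']]])
          (auto simp: restr_def S_def)
    qed auto
    moreover have "restr T p \<in> queue_invs R {} Z"
      unfolding T_def
      by (rule queue_invs_restr[OF p']) (use T lt in \<open>auto simp: T_def\<close>)
    ultimately show ?thesis by (intro glue_restr[OF ip' S dis])
  qed
  moreover have "p \<in> ?L" if p: "p \<in> ?G" for p
  proof -
    obtain f g where f: "f \<in> queue_invs {} {a..<d} {}" and g: "g \<in> queue_invs R {} Z"
      and i_f: "inv_on S f" and ig: "inv_on T g" and ip: "inv_on (S \<union> T) p"
      and px: "\<And>x. p x = (if x \<in> S then f x else g x)"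
      by (rule glueE[OF p queue_invs_subset[of "{}" "{a..<d}" "{}", folded S_def]
          queue_invs_subset[of R "{}" Z, folded T_def] dis]) blast
    have ip': "inv_on (R \<union> {a..<Suc d} \<union> Z) p"
      unfolding un by (rule inv_on_subset_fixed[OF ip]) auto
    have pd: "p d = d" by (rule inv_on_outside[OF ip dnot])
    have pS: "p x = f x" "p x \<in> S" if "x \<in> S" for x
      using inv_on_mem[OF i_f that] that by (auto simp: px)
    have pg: "p x = g x" if "x \<notin> S" for x using that by (simp add: px)
    have notZ: "p x \<notin> Z" if "x \<in> {a..<Suc d}" for x
    proof (cases "x = d")
      case True then show ?thesis using pd lt[of d d] ad by auto
    next
      case False
      then have "x \<in> S" using that by (auto simp: S_def)
      from pS(2)[OF this] have "p x \<in> {a..<Suc d}" by (auto simp: S_def)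
      then show ?thesis using lt[of "p x" "p x"] by blast
    qed
    have "p \<in> queue_invs R {a..<Suc d} Z"
    proof (rule queue_invsI[OF ip'])
      show "p x \<in> Z" if "x \<in> R" for x
      proof -
        have "x \<notin> S" using that dis by (auto simp: T_def)
        then show ?thesis using pg queue_invsD(2)[OF g that] by simp
      qed
      show "avoids_132_on {a..<Suc d} p"
        unfolding avoids_132_on_def
      proof (intro ballI impI)
        fix i j k assume m: "i \<in> {a..<Suc d}" "j \<in> {a..<Suc d}" "k \<in> {a..<Suc d}"
          and o: "i < j" "j < k" "p i < p k"
        then have S: "i \<in> S" "j \<in> S" by (auto simp: S_def)
        show "p j \<le> p k"
        proof (cases "k = d")
          case True then show ?thesis using pS(2)[OF S(2)] pd by (auto simp: S_def)
        next
          case False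
          then have "k \<in> S" using m by (auto simp: S_def)
          then show ?thesis
            using avoids_132_onD[OF queue_invsD(3)[OF f], of i j k] S o pS(1) by (simp add: S_def)
        qed
      qed
      show "p i < p j" if o: "i < j" "j \<le> p j" "p j \<in> Z" for i j
      proof -
        have "j \<notin> S" using notZ[of j] o(3) by (auto simp: S_def)
        then have pj: "p j = g j" by (rule pg)
        show ?thesis
        proof (cases "i \<in> S")
          case True
          then show ?thesis using pS(2)[OF True] lt[of "p i" "p j"] o(3) by (auto simp: S_def)
        next
          case False
          then show ?thesis using queue_invsD(4)[OF g o(1)] o pj pg by simp
        qed
      qed
      show "\<exists>i<z. z \<le> p i" if z: "z \<in> Z" for z
      proof -
        obtain i where i: "i < z" "z \<le> g i" using queue_invsD(5)[OF g z] by blast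
        have "i \<notin> S" using inv_on_outside[OF ig, of i] dis i by auto
        with i show ?thesis using pg by auto
      qed
    qed
    with pd notZ[of a] ad show ?thesis by simp
  qed
  ultimately show ?thesis by blast
qed

text \<open>None of the first \<open>i + 1\<close> points enters the queue: one strictly between
  \<open>a\<close> and \<open>a + i\<close> would have a value above \<open>d = p (a + i)\<close>
  and form a 132 with \<open>a\<close> and \<open>a + i\<close>. Their image is moreover closed
  upwards within the middle interval, hence is its last \<open>i + 1\<close> points.\<close>

lemma queue_invs_outer_image:
  assumes p: "p \<in> queue_invs R {a..<Suc d} Z"
    and lt: "\<And>x z. x \<in> R \<union> {a..<Suc d} \<Longrightarrow> z \<in> Z \<Longrightarrow> x < z"
    and pa: "p a \<notin> Z" and pd: "p d = a + i" and le: "a + i < d"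
  shows "p ` {a..<a + Suc i} = {d - i..<Suc d}"
proof -
  define A where "A = {a..<a + Suc i}"
  note p' = p
  note ip = queue_invsD(1)[OF p]
  have pp: "p (p x) = x" for x by (rule inv_on_invol[OF ip])
  have pq: "p (a + i) = d" using pp[of d] pd by simp
  have notR: "p x \<notin> R" if "x \<in> {a..<Suc d}" for x
    using queue_invsD(2)[OF p', of "p x"] that lt[of x x] unfolding pp by blast
  have mem: "p x \<in> {a..<Suc d}" if "x \<in> {a..<Suc d}" "p x \<notin> Z" for x
    using inv_on_mem[OF ip, of x] notR[OF that(1)] that by blast
  have inM: "p c \<in> {a..<Suc d}" if c: "c \<in> A" for c
  proof -
    have cM: "c \<in> {a..<Suc d}" using c le by (auto simp: A_def)
    have am: "p a \<in> {a..<Suc d}" by (rule mem) (use pa le in auto)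
    show ?thesis
    proof (rule mem[OF cM], rule)
      assume z: "p c \<in> Z"
      then have "p c > d" using lt[of d "p c"] le by auto
      then have "c \<noteq> a" "c \<noteq> a + i" using pq am by auto
      then have o: "a < c" "c < a + i" using c by (auto simp: A_def)
      then have "p a \<noteq> p (a + i)" using inv_on_eq_iff[OF ip, of a "a + i"] by simp
      then have "p a < p (a + i)" using am pq by simp
      then have "p c \<le> p (a + i)"
        by (intro avoids_132_onD[OF queue_invsD(3)[OF p'], of a]) (use o le in auto)
      with \<open>p c > d\<close> pq show False by simp
    qed
  qed
  have "p ` A = {Suc d - card (p ` A)..<Suc d}"
  proof (rule upward_closed_eq)
    show "p ` A \<subseteq> {a..<Suc d}" using inM by blast
    fix x y assume x: "x \<in> p ` A" and y: "x < y" "y < Suc d"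
    show "y \<in> p ` A"
    proof (cases "y = d")
      case True
      then show ?thesis using pq by (force simp: A_def)
    next
      case False
      obtain c where c: "c \<in> A" "x = p c" using x by blast
      have "c \<noteq> a + i" using c y pq by auto
      then have lt': "p x < p d" using c pp[of c] pd by (auto simp: A_def)
      have yM: "y \<in> {a..<Suc d}" using inM[OF c(1)] c(2) y by auto
      \<comment> \<open>The positions \<open>x < y < d\<close> carry the values \<open>c\<close> and
        \<open>a + i\<close> at the ends, with \<open>c < a + i\<close>. The bound on
        \<open>p y\<close> shows that \<open>y\<close> is the image of one of the first
        \<open>i + 1\<close> points.\<close>
      have "p y \<le> p d"
        by (rule avoids_132_onD[OF queue_invsD(3)[OF p'], of x])
          (use inM[OF c(1)] c(2) y yM False lt' in auto)
      then have le': "p y \<le> a + i" using pd by simp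
      have "p y \<notin> Z" using lt[of d "p y"] le' le by auto
      then have "p y \<in> A" using mem[OF yM] le' by (auto simp: A_def)
      then show ?thesis using pp[of y] by (metis image_eqI)
    qed
  qed
  also have "card (p ` A) = Suc i"
  proof -
    have "inj_on p A" by (rule inj_onI) (use inv_on_eq_iff[OF ip] in blast)
    then show ?thesis using card_image[of p A] by (simp add: A_def)
  qed
  finally show ?thesis by (simp add: A_def)
qed

text \<open>The filter on \<open>swap_invs\<close> puts the largest value in the last position,
  which for a 132-avoiding bijection means that it is no proper skew sum; thus exactly one layer is
  removed at a time. The term \<open>d - i + i\<close> is \<open>d\<close> in the form
  \<open>b + n\<close> of \<open>swap_invs_step\<close>.\<close>

lemma queue_invs_outer_layer:
  assumes lt: "\<And>x z. x \<in> R \<union> {a..<Suc d} \<Longrightarrow> z \<in> Z \<Longrightarrow> x < z"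
    and disj: "R \<inter> {a..<Suc d} = {}" and le: "a + i < d - i"
  shows "{p \<in> queue_invs R {a..<Suc d} Z. p a \<notin> Z \<and> p d = a + i} =
    glue {p \<in> swap_invs a (d - i) (Suc i). p (d - i + i) = a + i}
      (queue_invs R {a + Suc i..<d - i} Z)" (is "?L = glue ?P ?Q")
proof -
  define A where "A = {a..<a + Suc i}"
  define B where "B = {d - i..<d - i + Suc i}"
  define N where "N = {a + Suc i..<d - i}"
  define T where "T = R \<union> N \<union> Z"
  have M: "{a..<Suc d} = A \<union> N \<union> B" using le by (auto simp: A_def N_def B_def)
  have un: "R \<union> {a..<Suc d} \<union> Z = (A \<union> B) \<union> T" unfolding M by (auto simp: T_def)
  have MZ: "x \<notin> Z" if "x \<in> A \<union> N \<union> B" for x using lt[of x x] that unfolding M by blast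
  have dis: "(A \<union> B) \<inter> T = {}"
    using disj MZ le unfolding M by (auto simp: T_def A_def B_def N_def)
  have di: "d - i + i = d" using le by simp
  have dB: "d \<in> B" "a \<in> A" using le by (auto simp: B_def A_def)
  have P: "?P \<subseteq> {p. inv_on (A \<union> B) p}"
    using swap_invs_subset[of a "d - i" "Suc i"] unfolding A_def B_def by blast
  have Q: "?Q \<subseteq> {p. inv_on T p}" unfolding T_def N_def by (rule queue_invs_subset)
  have "p \<in> glue ?P ?Q" if p: "p \<in> ?L" for p
  proof -
    have p': "p \<in> queue_invs R {a..<Suc d} Z" and pa: "p a \<notin> Z" and pd: "p d = a + i" using p by auto
    note ip = queue_invsD(1)[OF p']
    have pp: "p (p x) = x" for x by (rule inv_on_invol[OF ip])
    have pq: "p (a + i) = d" using pp[of d] pd by simp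
    have im: "p ` A = B"
    proof -
      have e: "d - i + Suc i = Suc d" using le by simp
      have "p ` {a..<a + Suc i} = {d - i..<Suc d}"
        by (rule queue_invs_outer_image[OF p' lt pa pd]) (use le in simp_all)
      then show ?thesis unfolding A_def B_def e .
    qed
    have S: "p ` (A \<union> B) \<subseteq> A \<union> B" unfolding im[symmetric] by (auto simp: pp)
    note ip' = ip[unfolded un]
    have T: "p ` T \<subseteq> T" by (rule image_complement_inv_on[OF ip' S dis])
    have "restr (A \<union> B) p \<in> ?P"
      unfolding swap_invs_def mem_Collect_eq A_def[symmetric] B_def[symmetric]
    proof (intro conjI)
      show "inv_on (A \<union> B) (restr (A \<union> B) p)" by (rule inv_on_restr[OF ip S])
      show "restr (A \<union> B) p ` A \<subseteq> B" using im by (auto simp: restr_def)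
      show "avoids_132_on A (restr (A \<union> B) p)"
        by (rule avoids_132_on_cong[OF avoids_132_on_mono[OF queue_invsD(3)[OF p']]])
          (use M in \<open>auto simp: restr_def\<close>)
      show "restr (A \<union> B) p (d - i + i) = a + i" using pd dB by (simp add: restr_def di)
    qed
    moreover have "restr T p \<in> ?Q"
      unfolding T_def N_def
    proof (rule queue_invs_restr[OF p'])
      show "p ` (R \<union> {a + Suc i..<d - i} \<union> Z) \<subseteq> R \<union> {a + Suc i..<d - i} \<union> Z"
        using T unfolding T_def N_def .
    qed (use lt in auto)
    ultimately show ?thesis by (intro glue_restr[OF ip' S dis])
  qed
  moreover have "p \<in> ?L" if p: "p \<in> glue ?P ?Q" for p
  proof -
    obtain f g where f: "f \<in> ?P" and g: "g \<in> ?Q"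
      and i_f: "inv_on (A \<union> B) f" and ig: "inv_on T g" and ip: "inv_on ((A \<union> B) \<union> T) p"
      and px: "\<And>x. p x = (if x \<in> A \<union> B then f x else g x)"
      by (rule glueE[OF p P Q dis]) blast
    have f': "f \<in> swap_invs a (d - i) (Suc i)" and fd: "f d = a + i" using f by (auto simp: di)
    have pf: "p x = f x" if "x \<in> A \<union> B" for x using that by (simp add: px)
    have pg: "p x = g x" if "x \<notin> A \<union> B" for x using that by (simp add: px)
    have pA: "p x \<in> B" if "x \<in> A" for x
      using swap_invsD(2)[OF f', of x] that pf[of x] by (simp add: A_def B_def)
    have pB: "p x \<in> A" if "x \<in> B" for x
      using swap_invs_inverse[OF f', of x] that pf[of x] by (simp add: A_def B_def)
    have gR: "g x \<in> Z" if "x \<in> R" for x by (rule queue_invsD(2)[OF g that])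
    have pN: "p x \<in> N \<union> Z" "p x = g x" if "x \<in> N" for x
    proof -
      have x: "x \<notin> A \<union> B" using that by (auto simp: A_def B_def N_def)
      then show "p x = g x" by (rule pg)
      have "g x \<in> R \<union> N \<union> Z" using inv_on_mem[OF ig, of x] that by (auto simp: T_def)
      moreover have "g x \<notin> R"
        using gR[of "g x"] inv_on_invol[OF ig, of x] MZ[of x] that by auto
      ultimately show "p x \<in> N \<union> Z" using pg[OF x] by simp
    qed
    have big: "z > x" if "x \<in> A \<union> N \<union> B" "z \<in> Z" for x z
      using lt[of x z] that unfolding M by blast
    have incr: "p u < p v" if o: "u < v" "v \<le> p v" "p v \<in> Z" for u v
    proof -
      have "v \<notin> A \<union> B" using pA[of v] pB[of v] MZ[of "p v"] o(3) by auto
      note v = pg[OF this]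
      show ?thesis
      proof (cases "u \<in> A \<union> B")
        case True
        then have "p u \<in> A \<union> N \<union> B" using pA[of u] pB[of u] by auto
        then show ?thesis using big o(3) by blast
      next
        case False
        then show ?thesis using queue_invsD(4)[OF g o(1)] o v pg by simp
      qed
    qed
    have "p \<in> queue_invs R {a..<Suc d} Z"
    proof (rule queue_invsI)
      show "inv_on (R \<union> {a..<Suc d} \<union> Z) p" unfolding un by (rule ip)
      show "p x \<in> Z" if "x \<in> R" for x
      proof -
        have "x \<notin> A \<union> B" using that dis by (auto simp: T_def)
        then show ?thesis using pg gR[OF that] by simp
      qed
      show "avoids_132_on {a..<Suc d} p"
        unfolding avoids_132_on_def
      proof (intro ballI impI)
        fix u v w assume m: "u \<in> {a..<Suc d}" "v \<in> {a..<Suc d}" "w \<in> {a..<Suc d}"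
          and o: "u < v" "v < w" "p u < p w"
        \<comment> \<open>\<open>A\<close> takes values in \<open>B\<close>, above \<open>N\<close>,
          and \<open>B\<close> takes values in \<open>A\<close>, below everything else. So a 132
          ending in \<open>A\<close> or \<open>B\<close> stays there, and one starting in
          \<open>A\<close> and ending in \<open>N\<close> would need a last value in
          \<open>Z\<close>, where non-nesting applies.\<close>
        consider "w \<in> A" | "w \<in> N" | "w \<in> B" using m(3) unfolding M by blast
        then show "p v \<le> p w"
        proof cases
          case 1
          then have "u \<in> A" "v \<in> A" using m o by (auto simp: A_def)
          then show ?thesis
            using avoids_132_onD[OF swap_invsD(3)[OF f', folded A_def], of u v w] 1 o pf by simp
        next
          case 2
          show ?thesis
          proof (cases "u \<in> N")
            case True
            then have v: "v \<in> N" using 2 o by (auto simp: N_def)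
            have "avoids_132_on N g" using queue_invsD(3)[OF g] unfolding N_def .
            from avoids_132_onD[OF this True v 2 o(1,2)] o(3) show ?thesis
              using True v 2 pN(2) by simp
          next
            case False
            then have "u \<in> A" using m(1) o 2 unfolding M by (auto simp: B_def N_def)
            then have "p w \<notin> N" using pA[of u] o by (auto simp: B_def N_def)
            then have "p w \<in> Z" using pN(1)[OF 2] by blast
            then have "p v < p w"
              by (intro incr o) (use big[of w "p w"] 2 in auto)
            then show ?thesis by simp
          qed
        next
          case 3
          have "p u \<in> A"
          proof -
            have "p u < a + Suc i" using pB[OF 3] o by (auto simp: A_def)
            moreover have "z \<notin> Z" if "z < a + Suc i" for z
              using big[of a z] big[of "a + i" z] dB that by (auto simp: A_def)
            ultimately show ?thesis
              using pA[of u] pN(1)[of u] pB[of u] m(1) le unfolding M by (auto simp: B_def N_def)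
          qed
          then have "u \<in> B"
            using pA[of u] pN(1)[of u] m(1) MZ[of "p u"] le unfolding M
            by (auto simp: A_def B_def N_def)
          then have "v \<in> B" using o 3 by (auto simp: B_def)
          then show ?thesis
            using avoids_132_onD[OF swap_invs_avoids_inverse[OF f', folded B_def], of u v w] 3 o pf
              \<open>u \<in> B\<close> by simp
        qed
      qed
      show "\<exists>u<z. z \<le> p u" if z: "z \<in> Z" for z
      proof -
        obtain u where u: "u < z" "z \<le> g u" using queue_invsD(5)[OF g z] by blast
        have "u \<notin> A \<union> B" using inv_on_outside[OF ig, of u] dis u by auto
        with u show ?thesis using pg by auto
      qed
    qed (rule incr)
    moreover have "p a \<notin> Z" using pA[OF dB(2)] MZ by blast
    moreover have "p d = a + i" using pf[of d] fd dB by simp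
    ultimately show ?thesis by simp
  qed
  ultimately show ?thesis by blast
qed

text \<open>If the two blocks of the layer overlapped, \<open>a + i\<close> would be a value both of
  \<open>d\<close> and of a point of the first block, against injectivity.\<close>

lemma queue_invs_no_crossing_layer:
  assumes lt: "\<And>x z. x \<in> R \<union> {a..<Suc d} \<Longrightarrow> z \<in> Z \<Longrightarrow> x < z"
    and le: "d - i \<le> a + i" "a + i < d"
  shows "{p \<in> queue_invs R {a..<Suc d} Z. p a \<notin> Z \<and> p d = a + i} = {}"
proof -
  have False if p: "p \<in> queue_invs R {a..<Suc d} Z" "p a \<notin> Z" "p d = a + i" for p
  proof -
    have im: "p ` {a..<a + Suc i} = {d - i..<Suc d}"
      by (rule queue_invs_outer_image[OF p(1) lt p(2,3) le(2)])
    have "a + i \<in> p ` {a..<a + Suc i}"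
      unfolding im using le by simp
    then obtain c where c: "c \<in> {a..<a + Suc i}" "p c = a + i" by force
    have "p c = p d" unfolding c(2) p(3) ..
    then have "c = d" unfolding inv_on_eq_iff[OF queue_invsD(1)[OF p(1)]] .
    with c(1) le show False by simp
  qed
  then show ?thesis by blast
qed

section \<open>Sum components of avoiders\<close>

definition avoids_2431_on :: "nat set \<Rightarrow> (nat \<Rightarrow> nat) \<Rightarrow> bool" where
  "avoids_2431_on S p \<longleftrightarrow> (\<forall>i\<in>S. \<forall>j\<in>S. \<forall>k\<in>S. \<forall>l\<in>S.
     i < j \<longrightarrow> j < k \<longrightarrow> k < l \<longrightarrow> p l < p i \<longrightarrow> p i < p k \<longrightarrow> p j \<le> p k)"

lemma avoids_2431_onD:
  "avoids_2431_on S p \<Longrightarrow> i \<in> S \<Longrightarrow> j \<in> S \<Longrightarrow> k \<in> S \<Longrightarrow> l \<in> S \<Longrightarrow>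
    i < j \<Longrightarrow> j < k \<Longrightarrow> k < l \<Longrightarrow> p l < p i \<Longrightarrow> p i < p k \<Longrightarrow> p j \<le> p k"
  unfolding avoids_2431_on_def by blast

definition avoid_invs :: "nat \<Rightarrow> nat \<Rightarrow> (nat \<Rightarrow> nat) set" where
  "avoid_invs a e = {p. inv_on {a..<e} p \<and> avoids_2431_on {a..<e} p}"

text \<open>The condition asks for an arc across the cut before each inner \<open>z\<close>, so no
  proper nonempty initial segment is mapped to itself: the involution is not a direct sum.\<close>

definition conn_invs :: "nat \<Rightarrow> nat \<Rightarrow> (nat \<Rightarrow> nat) set" where
  "conn_invs a e = {p \<in> avoid_invs a e. \<forall>z\<in>{a<..<e}. \<exists>i<z. z \<le> p i}"

lemma avoid_invs_subset: "avoid_invs a e \<subseteq> {p. inv_on {a..<e} p}"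
  unfolding avoid_invs_def by blast

lemma conn_invs_subset: "conn_invs a e \<subseteq> {p. inv_on {a..<e} p}"
  unfolding conn_invs_def avoid_invs_def by blast

lemma avoid_invs_empty: "avoid_invs a a = {id}"
proof -
  have "p = id" if "p \<in> avoid_invs a a" for p
  proof
    have i: "inv_on {a..<a} p" using that by (simp add: avoid_invs_def)
    show "p x = id x" for x using inv_on_outside[OF i, of x] by simp
  qed
  moreover have "id \<in> avoid_invs a a"
    by (simp add: avoid_invs_def inv_on_def avoids_2431_on_def)
  ultimately show ?thesis by blast
qed

text \<open>Characterises the end \<open>c\<close> of the first sum component without taking a
  minimum: the segment up to \<open>c\<close> is invariant, and every earlier cut is
  crossed.\<close>

definition first_block :: "nat \<Rightarrow> nat \<Rightarrow> (nat \<Rightarrow> nat) \<Rightarrow> bool" where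
  "first_block a c p \<longleftrightarrow> p ` {a..<c} \<subseteq> {a..<c} \<and> (\<forall>z\<in>{a<..<c}. \<exists>i<z. z \<le> p i)"

text \<open>2431 ends with its smallest entry, so an occurrence that starts in the first block also
  ends there; occurrences never straddle two sum components.\<close>

lemma avoid_invs_first_block:
  assumes c: "a < c" "c \<le> e"
  shows "{p \<in> avoid_invs a e. first_block a c p} = glue (conn_invs a c) (avoid_invs c e)" (is "?L = ?G")
proof -
  have dis: "{a..<c} \<inter> {c..<e} = {}" by auto
  have un: "{a..<e} = {a..<c} \<union> {c..<e}" using c by auto
  have "p \<in> ?G" if p: "p \<in> ?L" for p
  proof -
    have ip: "inv_on ({a..<c} \<union> {c..<e}) p" and av: "avoids_2431_on {a..<e} p"
      using p unfolding avoid_invs_def un by auto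
    have S: "p ` {a..<c} \<subseteq> {a..<c}" and cn: "\<forall>z\<in>{a<..<c}. \<exists>i<z. z \<le> p i"
      using p by (auto simp: first_block_def)
    have T: "p ` {c..<e} \<subseteq> {c..<e}" by (rule image_complement_inv_on[OF ip S dis])
    have avr: "avoids_2431_on X (restr X p)" if "X \<subseteq> {a..<e}" for X
      unfolding avoids_2431_on_def
    proof (intro ballI impI)
      fix i j k l assume m: "i \<in> X" "j \<in> X" "k \<in> X" "l \<in> X" and o: "i < j" "j < k" "k < l"
        and v: "restr X p l < restr X p i" "restr X p i < restr X p k"
      then show "restr X p j \<le> restr X p k"
        using avoids_2431_onD[OF av, of i j k l] that by (auto simp: restr_def subset_iff)
    qed
    have "restr {a..<c} p \<in> conn_invs a c"
      unfolding conn_invs_def avoid_invs_def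
    proof (intro CollectI conjI ballI)
      show "inv_on {a..<c} (restr {a..<c} p)" by (rule inv_on_restr[OF ip S])
      show "avoids_2431_on {a..<c} (restr {a..<c} p)" by (rule avr) (use c in auto)
      fix z assume z: "z \<in> {a<..<c}"
      then obtain i where i: "i < z" "z \<le> p i" using cn by blast
      have "i \<in> {a..<c}" using inv_on_outside[OF ip, of i] i z by fastforce
      with i show "\<exists>i<z. z \<le> restr {a..<c} p i" by (auto simp: restr_def)
    qed
    moreover have "restr {c..<e} p \<in> avoid_invs c e"
      unfolding avoid_invs_def
    proof (intro CollectI conjI)
      show "inv_on {c..<e} (restr {c..<e} p)" by (rule inv_on_restr[OF ip T])
      show "avoids_2431_on {c..<e} (restr {c..<e} p)" by (rule avr) (use c in auto)
    qed
    ultimately show ?thesis by (rule glue_restr[OF ip S dis])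
  qed
  moreover have "p \<in> ?L" if p: "p \<in> ?G" for p
  proof -
    obtain f g where f: "f \<in> conn_invs a c" and g: "g \<in> avoid_invs c e"
      and i_f: "inv_on {a..<c} f" and ig: "inv_on {c..<e} g" and ip: "inv_on ({a..<c} \<union> {c..<e}) p"
      and px: "\<And>x. p x = (if x \<in> {a..<c} then f x else g x)"
      by (rule glueE[OF p conn_invs_subset avoid_invs_subset dis]) blast
    have p1: "p x = f x" "p x \<in> {a..<c}" if "x \<in> {a..<c}" for x
      using px[of x] inv_on_mem[OF i_f that] that by auto
    have p2: "p x = g x" "p x \<in> {c..<e}" if "x \<in> {c..<e}" for x
      using px[of x] inv_on_mem[OF ig that] that by auto
    have avf: "avoids_2431_on {a..<c} f" and avg: "avoids_2431_on {c..<e} g"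
      and cf: "\<And>z. z \<in> {a<..<c} \<Longrightarrow> \<exists>i<z. z \<le> f i"
      using f g unfolding conn_invs_def avoid_invs_def by blast+
    have "avoids_2431_on {a..<e} p"
      unfolding avoids_2431_on_def
    proof (intro ballI impI)
      fix i j k l assume m: "i \<in> {a..<e}" "j \<in> {a..<e}" "k \<in> {a..<e}" "l \<in> {a..<e}"
        and o: "i < j" "j < k" "k < l" "p l < p i" "p i < p k"
      show "p j \<le> p k"
      proof (cases "i < c")
        case True
        then have "p i < c" using p1(2)[of i] m by simp
        then have "l < c" using p2(2)[of l] o m by (cases "l < c") auto
        then have "i \<in> {a..<c}" "j \<in> {a..<c}" "k \<in> {a..<c}" "l \<in> {a..<c}" using m o by auto
        then show ?thesis
          using avoids_2431_onD[OF avf, of i j k l] o p1(1) by simp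
      next
        case False
        then have "i \<in> {c..<e}" "j \<in> {c..<e}" "k \<in> {c..<e}" "l \<in> {c..<e}" using m o by auto
        then show ?thesis
          using avoids_2431_onD[OF avg, of i j k l] o p2(1) by simp
      qed
    qed
    moreover have "first_block a c p"
      unfolding first_block_def
    proof (intro conjI ballI)
      show "p ` {a..<c} \<subseteq> {a..<c}" using p1(2) by blast
      fix z assume z: "z \<in> {a<..<c}"
      obtain i where i: "i < z" "z \<le> f i" using cf[OF z] by blast
      have "i \<in> {a..<c}" using inv_on_outside[OF i_f, of i] i by force
      with i show "\<exists>i<z. z \<le> p i" using p1(1) by auto
    qed
    ultimately show ?thesis using ip unfolding avoid_invs_def un by simp
  qed
  ultimately show ?thesis by blast
qed

lemma first_block_exists:
  assumes ip: "inv_on {a..<e} p" and ae: "a < e"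
  shows "\<exists>c\<in>{a<..e}. first_block a c p"
proof -
  \<comment> \<open>Minimality of the invariant segment supplies the crossing arc at every earlier
    cut.\<close>
  define c where "c = (LEAST c. a < c \<and> p ` {a..<c} \<subseteq> {a..<c})"
  have e: "a < e \<and> p ` {a..<e} \<subseteq> {a..<e}"
    using ae inv_on_mem[OF ip] by blast
  have c: "a < c" "p ` {a..<c} \<subseteq> {a..<c}"
    using LeastI[of "\<lambda>c. a < c \<and> p ` {a..<c} \<subseteq> {a..<c}", OF e] by (simp_all add: c_def)
  have ce: "c \<le> e"
    using Least_le[of "\<lambda>c. a < c \<and> p ` {a..<c} \<subseteq> {a..<c}", OF e] by (simp add: c_def)
  have "\<exists>i<z. z \<le> p i" if z: "z \<in> {a<..<c}" for z
  proof -
    have "\<not> (a < z \<and> p ` {a..<z} \<subseteq> {a..<z})"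
      by (rule not_less_Least) (use z in \<open>simp add: c_def\<close>)
    then have "\<not> p ` {a..<z} \<subseteq> {a..<z}" using z by simp
    then obtain i where i: "i \<in> {a..<z}" "p i \<notin> {a..<z}" using z by blast
    have "p i \<in> {a..<e}" by (rule inv_on_mem[OF ip]) (use i z ce in auto)
    with i show ?thesis by auto
  qed
  with c(2) have "first_block a c p" unfolding first_block_def by blast
  with c(1) ce show ?thesis by (intro bexI[of _ c]) auto
qed

lemma first_block_unique:
  assumes ip: "inv_on {a..<e} p" and b: "first_block a c p" "first_block a c' p"
    and c: "a < c" "a < c'"
  shows "c = c'"
proof -
  have no: False if b: "first_block a c p" "first_block a c' p" and c: "a < c" "c < c'" for c c'
  proof -
    have "\<exists>i<c. c \<le> p i" using b(2) c unfolding first_block_def by (meson greaterThanLessThan_iff)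
    then obtain i where i: "i < c" "c \<le> p i" by blast
    have "i \<in> {a..<e}" using inv_on_outside[OF ip, of i] i by fastforce
    then have "i \<in> {a..<c}" using i by simp
    then have "p i \<in> {a..<c}" using b(1) unfolding first_block_def by blast
    with i show False by simp
  qed
  show ?thesis using no[OF b] no[OF b(2,1)] c by (meson linorder_neqE_nat)
qed

section \<open>Removing the arc of the smallest point\<close>

lemma conn_invs_singleton: "conn_invs a (Suc a) = {id}"
proof -
  have "p = id" if "p \<in> conn_invs a (Suc a)" for p
  proof
    have i: "inv_on {a..<Suc a} p" using that conn_invs_subset by blast
    show "p x = id x" for x
      using inv_on_outside[OF i, of x] inv_on_mem[OF i, of x] by (cases "x = a") auto
  qed
  moreover have "id \<in> conn_invs a (Suc a)"
    by (simp add: conn_invs_def avoid_invs_def inv_on_def avoids_2431_on_def)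
  ultimately show ?thesis by blast
qed

lemma conn_invs_first_arc:
  assumes p: "p \<in> conn_invs a e" and e: "Suc a < e"
  shows "p a \<in> {a<..<e}"
proof -
  have ip: "inv_on {a..<e} p" using p conn_invs_subset by blast
  have "Suc a \<in> {a<..<e}" using e by simp
  then obtain i where i: "i < Suc a" "Suc a \<le> p i"
    using p unfolding conn_invs_def by blast
  have "i = a"
  proof (rule ccontr)
    assume "i \<noteq> a"
    then have "p i = i" using i by (intro inv_on_outside[OF ip]) auto
    with i show False by simp
  qed
  then show ?thesis using i inv_on_mem[OF ip, of a] e by auto
qed

text \<open>Connectedness supplies the outer entries of a 2431: if two upward arcs are nested, choose the
  inner left end \<open>j\<close> minimal, let \<open>v\<close> be the last right end of an arc before \<open>j\<close>, and take an
  arc leading from below \<open>v\<close> to beyond \<open>v\<close>; it ends to the right of \<open>j\<close>.\<close>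

lemma conn_invs_increasing:
  assumes p: "p \<in> conn_invs a e" and pa: "p a = k" and k: "a < k"
  shows "i < j \<Longrightarrow> j \<le> p j \<Longrightarrow> k < p j \<Longrightarrow> p i < p j"
proof (induction j arbitrary: i rule: less_induct)
  case (less j)
  have ip: "inv_on {a..<e} p" using p conn_invs_subset by blast
  have av: "avoids_2431_on {a..<e} p" and cn: "\<And>z. z \<in> {a<..<e} \<Longrightarrow> \<exists>i<z. z \<le> p i"
    using p unfolding conn_invs_def avoid_invs_def by blast+
  have pp: "p (p x) = x" for x by (rule inv_on_invol[OF ip])
  have pk: "p k = a" using pp[of a] pa by simp
  have moved: "x \<in> {a..<e}" if "p x \<noteq> x" for x
    using inv_on_outside[OF ip, of x] that by blast
  have ke: "k < e" using moved[of k] pk k by simp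
  show ?case
  proof (rule ccontr)
    assume n: "\<not> p i < p j"
    have "p i \<noteq> p j" using inv_on_eq_iff[OF ip, of i j] less.prems by simp
    with n have gt: "p j < p i" by simp
    have im: "i \<in> {a..<e}" using moved[of i] gt less.prems by simp
    have "p i \<in> {a..<e}" by (rule inv_on_mem[OF ip im])
    then have jm: "j \<in> {a..<e}" using gt less.prems im by auto
    have ia: "i \<noteq> a" using gt pa less.prems by auto
    consider "j < k" | "j = k" | "k < j" by linarith
    then show False
    proof cases
      case 1
      have "p i \<le> p j"
        \<comment> \<open>Nested arcs starting before \<open>k\<close> give a 2431 at
          \<open>a\<close>, \<open>i\<close>, \<open>j\<close>, \<open>k\<close>, with values
          \<open>k\<close>, \<open>p i\<close>, \<open>p j\<close>, \<open>a\<close>.\<close>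
        by (rule avoids_2431_onD[OF av, of a i j k])
          (use im jm ia 1 k ke pa pk less.prems in auto)
      with gt show False by simp
    next
      case 2
      with less.prems pk k show False by simp
    next
      case 3
      define v where "v = (GREATEST v. v < j \<and> p v < v)"
      have ex: "k < j \<and> p k < k" using 3 pk k by simp
      have bd: "y \<le> j" if "y < j \<and> p y < y" for y using that by simp
      have v: "v < j" "p v < v"
        using GreatestI_nat[of "\<lambda>v. v < j \<and> p v < v", OF ex bd] by (simp_all add: v_def)
      have vmax: "y \<le> v" if "y < j" "p y < y" for y
        unfolding v_def by (rule Greatest_le_nat[of _ _ j]) (use that in auto)
      have kv: "k \<le> v" using vmax[of k] ex by simp
      obtain t where t: "t < Suc v" "Suc v \<le> p t"
        using cn[of "Suc v"] kv k v jm by auto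
      then have tv: "t < v" using v by (cases "t = v") auto
      have s: "p t > j"
      proof (rule ccontr)
        assume "\<not> p t > j"
        moreover have "p t \<noteq> j" using pp[of t] tv v less.prems by auto
        ultimately have "p t \<le> v" by (intro vmax) (use pp[of t] t in auto)
        with t show False by simp
      qed
      \<comment> \<open>For \<open>v\<close> other than \<open>k\<close> this is the minimality of
        \<open>j\<close>: the arc from \<open>p v\<close> to \<open>v\<close> starts earlier, so it
        cannot lie inside the arc from \<open>i\<close>.\<close>
      have ui: "p v < i"
      proof (cases "v = k")
        case True
        then show ?thesis using pk ia im by simp
      next
        case False
        have "p i < p (p v)" if "i < p v"
          by (rule less.IH[OF _ that]) (use v kv False pp[of v] in auto)
        moreover have "i \<noteq> p v" using pp[of v] gt v less.prems by auto
        ultimately show ?thesis using pp[of v] v gt less.prems by (cases "i < p v") auto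
      qed
      have vm: "v \<in> {a..<e}" "p v \<in> {a..<e}"
        using moved[of v] v inv_on_mem[OF ip, of v] by auto
      have tm: "t \<in> {a..<e}" "p t \<in> {a..<e}"
        using moved[of t] t tv inv_on_mem[OF ip, of t] by auto
      have "p i \<le> p j"
        \<comment> \<open>The values at these positions are \<open>v\<close>, \<open>p i\<close>,
          \<open>p j\<close>, \<open>t\<close>, with \<open>t < v < p j < p i\<close>.\<close>
        by (rule avoids_2431_onD[OF av, of "p v" i j "p t"])
          (use vm tm im jm ui s less.prems v tv pp[of t] pp[of v] in auto)
      with gt show False by simp
    qed
  qed
qed

text \<open>Column \<open>k\<close> holds the least value \<open>a\<close>, so it completes any 132
  strictly between \<open>a\<close> and \<open>k\<close> to a 2431. Conversely, every 2431 not of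
  this kind yields two nested arcs whose inner right end is beyond \<open>k\<close>.\<close>

lemma conn_invs_arc:
  assumes k: "a < k" "k < e"
  shows "{p \<in> conn_invs a e. p a = k} =
    glue (arc a k) (queue_invs {} {Suc a..<k} {Suc k..<e})" (is "?L = ?G")
proof -
  define S where "S = {a, k}"
  define M where "M = {Suc a..<k}"
  define Z where "Z = {Suc k..<e}"
  define T where "T = {} \<union> M \<union> Z"
  have dis: "S \<inter> T = {}" using k by (auto simp: S_def T_def M_def Z_def)
  have un: "{a..<e} = S \<union> T" using k by (auto simp: S_def T_def M_def Z_def)
  have "p \<in> ?G" if p: "p \<in> ?L" for p
  proof -
    have p': "p \<in> conn_invs a e" and pa: "p a = k" using p by auto
    have ip: "inv_on {a..<e} p" using p' conn_invs_subset by blast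
    have av: "avoids_2431_on {a..<e} p" and cn: "\<And>z. z \<in> {a<..<e} \<Longrightarrow> \<exists>i<z. z \<le> p i"
      using p' unfolding conn_invs_def avoid_invs_def by blast+
    have pk: "p k = a" using inv_on_invol[OF ip, of a] pa by simp
    have S: "p ` S \<subseteq> S" using pa pk by (auto simp: S_def)
    note ip' = ip[unfolded un]
    have T: "p ` T \<subseteq> T" by (rule image_complement_inv_on[OF ip' S dis])
    define q where "q = restr T p"
    have qx: "q x = (if x \<in> S then x else p x)" for x
      using inv_on_outside[OF ip', of x] dis by (auto simp: q_def restr_def)
    have "q \<in> queue_invs {} M Z"
    proof (rule queue_invsI)
      show "inv_on ({} \<union> M \<union> Z) q"
        unfolding q_def T_def[symmetric] by (rule inv_on_restr[OF ip T])
      have "avoids_132_on M p"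
        unfolding avoids_132_on_def
      proof (intro ballI impI)
        fix u v w assume m: "u \<in> M" "v \<in> M" "w \<in> M" and o: "u < v" "v < w" "p u < p w"
        have "p u \<in> {a..<e}" by (rule inv_on_mem[OF ip]) (use m k in \<open>auto simp: M_def\<close>)
        moreover have "p u \<noteq> p k" using inv_on_eq_iff[OF ip, of u k] m by (auto simp: M_def)
        ultimately have "p k < p u" using pk by auto
        then show "p v \<le> p w"
          by (intro avoids_2431_onD[OF av, of u v w k]) (use m o k in \<open>auto simp: M_def\<close>)
      qed
      then show "avoids_132_on M q"
        by (rule avoids_132_on_cong) (auto simp: q_def restr_def T_def)
      show "q i < q j" if o: "i < j" "j \<le> q j" "q j \<in> Z" for i j
      proof -
        have "j \<notin> S" using o k by (auto simp: qx Z_def S_def split: if_splits)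
        then have qj: "q j = p j" by (simp add: qx)
        have "p i < p j"
          by (rule conn_invs_increasing[OF p' pa k(1) o(1)]) (use o qj in \<open>auto simp: Z_def\<close>)
        then show ?thesis using qj o by (auto simp: qx)
      qed
      show "\<exists>i<z. z \<le> q i" if z: "z \<in> Z" for z
      proof -
        obtain i where i: "i < z" "z \<le> p i" using cn[of z] z k by (auto simp: Z_def)
        then have "i \<notin> S" using pa pk k z by (auto simp: S_def Z_def)
        with i show ?thesis by (auto simp: qx)
      qed
    qed simp
    then show ?thesis
      using glue_restr[OF ip' S dis restr_arc[OF ip pa, folded S_def]] by (simp add: q_def M_def Z_def)
  qed
  moreover have "p \<in> ?L" if p: "p \<in> ?G" for p
  proof -
    obtain s q where s: "s \<in> arc a k" and q: "q \<in> queue_invs {} M Z"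
      and iq: "inv_on T q" and ip': "inv_on (S \<union> T) p"
      and px: "\<And>x. p x = (if x \<in> S then s x else q x)"
      by (rule glueE[OF p[folded M_def Z_def] arc_inv_on[of a k, folded S_def]
          queue_invs_subset[of "{}" M Z, folded T_def] dis]) blast
    note ip = ip'[folded un]
    have pp: "p (p x) = x" for x by (rule inv_on_invol[OF ip])
    have pa: "p a = k" "p k = a" using arcD[OF s] by (auto simp: px S_def)
    have pq: "p x = q x" if "x \<noteq> a" "x \<noteq> k" for x using that by (simp add: px S_def)
    have incr: "p x < p y" if o: "x < y" "y \<le> p y" "k < p y" for x y
    proof -
      have y: "y \<noteq> a" "y \<noteq> k" using o pa k by auto
      show ?thesis
      proof (cases "y \<in> {a..<e}")
        case True
        then have z: "q y \<in> Z" using inv_on_mem[OF ip True] o pq[OF y] by (auto simp: Z_def)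
        show ?thesis
        proof (cases "x = a \<or> x = k")
          case True then show ?thesis using pa o k by auto
        next
          case False
          then show ?thesis using queue_invsD(4)[OF q o(1) _ z] o(2) pq[OF y] pq[of x] by simp
        qed
      next
        case False
        then have "p y = y" by (rule inv_on_outside[OF ip])
        moreover have "e \<le> y" using False o k \<open>p y = y\<close> by auto
        ultimately show ?thesis
          using inv_on_mem[OF ip, of x] inv_on_outside[OF ip, of x] o by (cases "x \<in> {a..<e}") auto
      qed
    qed
    have "avoids_2431_on {a..<e} p"
      unfolding avoids_2431_on_def
    proof (intro ballI impI, rule ccontr)
      fix u v w x assume m: "u \<in> {a..<e}" "v \<in> {a..<e}" "w \<in> {a..<e}" "x \<in> {a..<e}"
        and o: "u < v" "v < w" "w < x" "p x < p u" "p u < p w" and n: "\<not> p v \<le> p w"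
      consider "w < k" | "w = k" | "k < w" by linarith
      then show False
      proof cases
        case 1
        show False
        proof (cases "u = a")
          case True
          have "p v < p w" by (rule incr[OF o(2)]) (use True pa o 1 in auto)
          with n show False by simp
        next
          case False
          then have "u \<in> M" "v \<in> M" "w \<in> M" using m o 1 by (auto simp: M_def)
          then have "q v \<le> q w"
            using avoids_132_onD[OF queue_invsD(3)[OF q], of u v w] o pq by (auto simp: M_def)
          then show False using n pq[of v] pq[of w] m o 1 False by simp
        qed
      next
        case 2
        with o pa inv_on_mem[OF ip m(1)] show False by simp
      next
        case 3
        show False
        proof (cases "w \<le> p w")
          case True
          then have "p v < p w" by (intro incr o) (use 3 in auto)
          with n show False by simp
        next
          case False
          \<comment> \<open>The arcs \<open>(p w, w)\<close> and \<open>(p x, x)\<close> would be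
            nested, since \<open>p x < p w < w < x\<close>.\<close>
          have "p (p x) < p (p w)" by (rule incr) (use 3 o False pp in auto)
          with o show False by (simp add: pp)
        qed
      qed
    qed
    moreover have "\<exists>i<z. z \<le> p i" if z: "z \<in> {a<..<e}" for z
    proof (cases "z \<le> k")
      case True then show ?thesis using pa z by (intro exI[of _ a]) auto
    next
      case False
      then have "z \<in> Z" using z by (auto simp: Z_def)
      then obtain i where i: "i < z" "z \<le> q i" using queue_invsD(5)[OF q] by blast
      then have "i \<in> T" using inv_on_outside[OF iq, of i] by force
      then have "i \<noteq> a" "i \<noteq> k" using dis by (auto simp: S_def)
      with i show ?thesis using pq[of i] by auto
    qed
    ultimately show ?thesis using ip pa by (simp add: conn_invs_def avoid_invs_def)
  qed
  ultimately show ?thesis by blast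
qed

section \<open>Counting\<close>

fun catalan :: "nat \<Rightarrow> nat" where
  "catalan 0 = 1"
| "catalan (Suc n) = (\<Sum>i\<le>n. catalan i * catalan (n - i))"

text \<open>Ballot paths with \<open>N\<close> unit steps from height \<open>r\<close> to 0. Height
  0 is reached only at the end, because a point arriving at an empty queue would start a new sum
  component.\<close>

fun queue_count :: "nat \<Rightarrow> nat \<Rightarrow> nat" where
  "queue_count 0 0 = 1"
| "queue_count 0 (Suc N) = 0"
| "queue_count (Suc r) 0 = 0"
| "queue_count (Suc r) (Suc N) = queue_count r N + queue_count (Suc (Suc r)) N"

text \<open>The arguments of \<open>mid_count\<close> are the cardinalities of \<open>R\<close>, \<open>M\<close> and \<open>Z\<close> in
  \<open>queue_invs R M Z\<close>. The auxiliary functions count those \<open>p\<close> that do not map the minimum of \<open>M\<close>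
  (and, for the last function, the maximum) into \<open>Z\<close>; there the second argument is \<open>card M - 1\<close>.\<close>

fun mid_count :: "nat \<Rightarrow> nat \<Rightarrow> nat \<Rightarrow> nat"
  and mid_count_min :: "nat \<Rightarrow> nat \<Rightarrow> nat \<Rightarrow> nat"
  and mid_count_minmax :: "nat \<Rightarrow> nat \<Rightarrow> nat \<Rightarrow> nat" where
  "mid_count r 0 N = queue_count r N"
| "mid_count r (Suc m) N = mid_count (Suc r) m N + mid_count_min r m N"
| "mid_count_min r 0 N = mid_count_minmax r 0 N"
| "mid_count_min r (Suc m) N = mid_count_min (Suc r) m N + mid_count_minmax r (Suc m) N"
| "mid_count_minmax r m N = mid_count 0 m 0 * queue_count r N +
     (\<Sum>i<m. if 2 * i < m then catalan i * mid_count r (m - 2 * i - 1) N else 0)"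

fun conn_count :: "nat \<Rightarrow> nat" where
  "conn_count 0 = 0"
| "conn_count (Suc 0) = 1"
| "conn_count (Suc (Suc n)) = (\<Sum>i\<le>n. mid_count 0 i (n - i))"

fun avoid_count :: "nat \<Rightarrow> nat" where
  "avoid_count 0 = 1"
| "avoid_count (Suc n) = (\<Sum>i\<le>n. conn_count (Suc i) * avoid_count (n - i))"

section \<open>Cardinalities of the decompositions\<close>

lemma card_fibres:
  assumes "finite X" "finite I" "\<And>x. x \<in> X \<Longrightarrow> f x \<in> I"
  shows "card X = (\<Sum>i\<in>I. card {x \<in> X. f x = i})"
proof -
  have "X = (\<Union>i\<in>I. {x \<in> X. f x = i})" using assms(3) by blast
  then have "card X = card (\<Union>i\<in>I. {x \<in> X. f x = i})" by (rule arg_cong)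
  also have "\<dots> = (\<Sum>i\<in>I. card {x \<in> X. f x = i})"
    by (rule card_UN_disjoint) (use assms in auto)
  finally show ?thesis .
qed

lemma card_split:
  assumes "finite X"
  shows "card X = card {x \<in> X. P x} + card {x \<in> X. \<not> P x}"
proof -
  have "X = {x \<in> X. P x} \<union> {x \<in> X. \<not> P x}" by blast
  then have "card X = card ({x \<in> X. P x} \<union> {x \<in> X. \<not> P x})" by (rule arg_cong)
  also have "\<dots> = card {x \<in> X. P x} + card {x \<in> X. \<not> P x}"
    by (rule card_Un_disjoint) (use assms in auto)
  finally show ?thesis .
qed

lemma finite_swap_invs: "finite (swap_invs a b n)"
  by (rule finite_subset[OF swap_invs_subset finite_inv_on]) simp

lemma card_swap_invs: "a + n \<le> b \<Longrightarrow> card (swap_invs a b n) = catalan n"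
proof (induction n arbitrary: a b rule: less_induct)
  case (less n)
  show ?case
  proof (cases n)
    case 0
    then show ?thesis by (simp add: swap_invs_0)
  next
    case (Suc n')
    have m: "a \<le> p (b + n') \<and> p (b + n') < a + Suc n'" if "p \<in> swap_invs a b (Suc n')" for p
      using swap_invs_inverse[OF that, of "b + n'"] by simp
    have "card (swap_invs a b (Suc n')) =
        (\<Sum>i\<le>n'. card {p \<in> swap_invs a b (Suc n'). p (b + n') - a = i})"
      by (rule card_fibres[OF finite_swap_invs]) (use m in fastforce)+
    also have "\<dots> = (\<Sum>i\<le>n'. catalan i * catalan (n' - i))"
    proof (rule sum.cong[OF refl])
      fix i assume i: "i \<in> {..n'}"
      have "{p \<in> swap_invs a b (Suc n'). p (b + n') - a = i} = {p \<in> swap_invs a b (Suc n'). p (b + n') = a + i}"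
        using m by fastforce
      also have "\<dots> = glue (arc (a + i) (b + n'))
          (glue (swap_invs a (b + (n' - i)) i) (swap_invs (Suc (a + i)) b (n' - i)))"
        by (rule swap_invs_step) (use less.prems Suc i in auto)
      also have "card \<dots> = card (arc (a + i) (b + n')) *
          card (glue (swap_invs a (b + (n' - i)) i) (swap_invs (Suc (a + i)) b (n' - i)))"
        by (rule card_glue[OF arc_inv_on glue_subset[OF swap_invs_subset swap_invs_subset]])
          (use less.prems Suc i in auto)
      also have "card (glue (swap_invs a (b + (n' - i)) i) (swap_invs (Suc (a + i)) b (n' - i))) =
          card (swap_invs a (b + (n' - i)) i) * card (swap_invs (Suc (a + i)) b (n' - i))"
        by (rule card_glue[OF swap_invs_subset swap_invs_subset]) (use less.prems Suc i in auto)
      also have "card (swap_invs a (b + (n' - i)) i) = catalan i"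
        by (rule less.IH) (use less.prems Suc i in auto)
      also have "card (swap_invs (Suc (a + i)) b (n' - i)) = catalan (n' - i)"
        by (rule less.IH) (use less.prems Suc i in auto)
      finally show "card {p \<in> swap_invs a b (Suc n'). p (b + n') - a = i} = catalan i * catalan (n' - i)"
        by simp
    qed
    finally show ?thesis using Suc by simp
  qed
qed

text \<open>With the maximum last, the right block in the Catalan decomposition is empty and only
  the factor of size \<open>i\<close> remains.\<close>

lemma card_swap_invs_max:
  assumes "a + Suc i \<le> b"
  shows "card {p \<in> swap_invs a b (Suc i). p (b + i) = a + i} = catalan i"
proof -
  have "{p \<in> swap_invs a b (Suc i). p (b + i) = a + i} =
      glue (arc (a + i) (b + i)) (glue (swap_invs a (b + (i - i)) i) (swap_invs (Suc (a + i)) b (i - i)))"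
    by (rule swap_invs_step[OF assms]) simp
  also have "card \<dots> = card (arc (a + i) (b + i)) *
      card (glue (swap_invs a (b + (i - i)) i) (swap_invs (Suc (a + i)) b (i - i)))"
    by (rule card_glue[OF arc_inv_on glue_subset[OF swap_invs_subset swap_invs_subset]]) (use assms in auto)
  also have "card (glue (swap_invs a (b + (i - i)) i) (swap_invs (Suc (a + i)) b (i - i))) =
      card (swap_invs a (b + (i - i)) i) * card (swap_invs (Suc (a + i)) b (i - i))"
    by (rule card_glue[OF swap_invs_subset swap_invs_subset]) (use assms in auto)
  finally show ?thesis using assms by (simp add: card_swap_invs)
qed

lemma card_queue_invs_no_mid:
  "finite R \<Longrightarrow> (\<forall>x\<in>R. x < c) \<Longrightarrow> card (queue_invs R {} {c..<c + N}) = queue_count (card R) N"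
proof (induction N arbitrary: R c)
  case 0
  show ?case
  proof (cases "R = {}")
    case True
    then show ?thesis by (simp add: queue_invs_empty)
  next
    case False
    then obtain k where "card R = Suc k" using 0 by (metis card_gt_0_iff gr0_conv_Suc)
    with False show ?thesis by (simp add: queue_invs_empty_right)
  qed
next
  case (Suc N)
  show ?case
  proof (cases "R = {}")
    case True
    then show ?thesis by (simp add: queue_invs_empty_left del: add_Suc_right)
  next
    case False
    define r where "r = Min R"
    have r: "r \<in> R" "r < c" using Suc.prems False by (auto simp: r_def)
    obtain k where k: "card R = Suc k" using Suc.prems False by (metis card_gt_0_iff gr0_conv_Suc)
    let ?G = "glue (arc r c) (queue_invs (R - {r}) {} {Suc c..<Suc c + N})"
    let ?O = "queue_invs (insert c R) {} {Suc c..<Suc c + N}"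
    have dis: "{r, c} \<inter> (R - {r} \<union> {} \<union> {Suc c..<Suc c + N}) = {}"
      using Suc.prems r by auto
    \<comment> \<open>The two families differ in whether \<open>c\<close> is sent below or above
      itself.\<close>
    have "p \<notin> ?O" if "p \<in> ?G" for p
    proof
      assume "p \<in> ?O"
      then have "p c \<in> {Suc c..<Suc c + N}" by (rule queue_invsD(2)) simp
      moreover have "p c = r"
        by (rule glueE[OF that arc_inv_on queue_invs_subset dis]) (use arcD in force)
      ultimately show False using r by simp
    qed
    then have "?G \<inter> ?O = {}" by blast
    moreover have "finite ?G"
      by (rule finite_subset[OF glue_subset[OF arc_inv_on queue_invs_subset dis] finite_inv_on])
        (use Suc.prems in simp)
    moreover have "finite ?O" by (rule finite_queue_invs) (use Suc.prems in auto)
    moreover have "queue_invs R {} {c..<c + Suc N} = ?G \<union> ?O"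
      using queue_invs_step[of R c "c + Suc N"] Suc.prems False by (simp add: r_def)
    ultimately have "card (queue_invs R {} {c..<c + Suc N}) = card ?G + card ?O"
      by (simp add: card_Un_disjoint)
    also have "card ?G = card (queue_invs (R - {r}) {} {Suc c..<Suc c + N})"
      using card_glue[OF arc_inv_on queue_invs_subset dis] by simp
    also have "\<dots> = queue_count (card (R - {r})) N"
      by (rule Suc.IH) (use Suc.prems in \<open>auto simp: less_Suc_eq\<close>)
    also have "card ?O = queue_count (card (insert c R)) N"
      by (rule Suc.IH) (use Suc.prems in \<open>auto simp: less_Suc_eq\<close>)
    also have "card (insert c R) = Suc (card R)"
      using Suc.prems by (intro card_insert_disjoint) auto
    also have "card (R - {r}) = k" using r k by simp
    finally show ?thesis using k by simp
  qed
qed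

text \<open>\<open>R\<close> receives points from both ends of the middle interval, so it need not
  lie on one side of it.\<close>

definition mid_ok :: "nat set \<Rightarrow> nat \<Rightarrow> nat \<Rightarrow> nat \<Rightarrow> bool" where
  "mid_ok R a m c \<longleftrightarrow> finite R \<and> R \<inter> {a..<a + m} = {} \<and> (\<forall>x\<in>R \<union> {a..<a + m}. x < c)"

lemma mid_ok_mono:
  assumes "mid_ok R a m c" "a \<le> a'" "a' + m' \<le> a + m"
  shows "mid_ok R a' m' c"
proof -
  have "{a'..<a' + m'} \<subseteq> {a..<a + m}" using assms by auto
  with assms(1) show ?thesis unfolding mid_ok_def by blast
qed

lemma mid_ok_less: "mid_ok R a (Suc m) c \<Longrightarrow> x \<in> R \<union> {a..<Suc (a + m)} \<Longrightarrow> x < c"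
  unfolding mid_ok_def by simp

lemma finite_queue_invs_mid: "mid_ok R a m c \<Longrightarrow> finite (queue_invs R {a..<b} {c..<e})"
  by (rule finite_queue_invs) (auto simp: mid_ok_def)

text \<open>The induction hypothesis of \<open>card_queue_invs\<close> enters as an assumption:
  after the points at both ends are kept out of the queue, everything reduces to complete counts for
  at most \<open>m\<close> middle points. The fibres are taken over
  \<open>p (a + m)\<close>.\<close>

lemma card_mid_minmax:
  fixes N :: nat
  assumes IH: "\<And>R a c N m'. m' \<le> m \<Longrightarrow> mid_ok R a m' c \<Longrightarrow>
      card (queue_invs R {a..<a + m'} {c..<c + N}) = mid_count (card R) m' N"
    and ok: "mid_ok R a (Suc m) c"
  defines "Z \<equiv> {c..<c + N}"
  shows "card {p \<in> queue_invs R {a..<Suc (a + m)} Z. p a \<notin> Z \<and> p (a + m) \<notin> Z} =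
    mid_count_minmax (card R) m N" (is "card ?X = _")
proof -
  let ?d = "a + m"
  let ?Q = "queue_invs R {a..<Suc ?d} Z"
  have lt: "x < z" if "x \<in> R \<union> {a..<Suc ?d}" "z \<in> Z" for x z
    using mid_ok_less[OF ok that(1)] that(2) by (simp add: Z_def)
  have disj: "R \<inter> {a..<Suc ?d} = {}" and finR: "finite R" using ok by (auto simp: mid_ok_def)
  have fin: "finite ?Q" unfolding Z_def by (rule finite_queue_invs_mid[OF ok])
  have mem: "a \<le> p ?d \<and> p ?d \<le> ?d" if "p \<in> ?X" for p
  proof -
    have p: "p \<in> ?Q" "p ?d \<notin> Z" using that by auto
    note ip = queue_invsD(1)[OF p(1)]
    have "p ?d \<in> R \<union> {a..<Suc ?d} \<union> Z" by (rule inv_on_mem[OF ip]) simp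
    moreover have "p ?d \<notin> R"
      using queue_invsD(2)[OF p(1), of "p ?d"] inv_on_invol[OF ip, of ?d] lt[of ?d ?d] by auto
    ultimately show ?thesis using p(2) by simp
  qed
  have small: "a + i \<notin> Z" if "i \<le> m" for i using lt[of "a + i" "a + i"] that by auto
  have "card ?X = (\<Sum>i\<le>m. card {p \<in> ?X. p ?d - a = i})"
    by (rule card_fibres) (use fin mem in fastforce)+
  also have "\<dots> = (\<Sum>i\<le>m. card {p \<in> ?Q. p a \<notin> Z \<and> p ?d = a + i})"
  proof (rule sum.cong[OF refl])
    fix i assume i: "i \<in> {..m}"
    have "{p \<in> ?X. p ?d - a = i} = {p \<in> ?Q. p a \<notin> Z \<and> p ?d = a + i}"
      using mem small[of i] i by fastforce
    then show "card {p \<in> ?X. p ?d - a = i} = card {p \<in> ?Q. p a \<notin> Z \<and> p ?d = a + i}" by simp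
  qed
  also have "\<dots> = (\<Sum>i<m. card {p \<in> ?Q. p a \<notin> Z \<and> p ?d = a + i}) + card {p \<in> ?Q. p a \<notin> Z \<and> p ?d = ?d}"
    by (simp add: lessThan_Suc_atMost[symmetric])
  also have "{p \<in> ?Q. p a \<notin> Z \<and> p ?d = ?d} = glue (queue_invs {} {a..<?d} {}) (queue_invs R {} Z)"
    by (rule queue_invs_max_fixed) (use lt disj in auto)
  also have "card \<dots> = card (queue_invs {} {a..<?d} {}) * card (queue_invs R {} Z)"
    by (rule card_glue[OF queue_invs_subset queue_invs_subset])
      (use disj lt[of "_ :: nat"] in fastforce)
  \<comment> \<open>Taking \<open>N = 0\<close> makes \<open>Z\<close> empty: this counts
    132-avoiding involutions of \<open>m\<close> points.\<close>
  also have "card (queue_invs {} {a..<?d} {}) = mid_count 0 m 0"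
    using IH[of m "{}" a c 0] ok by (auto simp: mid_ok_def)
  also have "card (queue_invs R {} Z) = queue_count (card R) N"
    unfolding Z_def by (rule card_queue_invs_no_mid) (use ok in \<open>auto simp: mid_ok_def\<close>)
  \<comment> \<open>A layer occupies \<open>2 * i + 2\<close> of the \<open>m + 1\<close> middle
    points, which is possible exactly if \<open>2 * i < m\<close>.\<close>
  also have "(\<Sum>i<m. card {p \<in> ?Q. p a \<notin> Z \<and> p ?d = a + i}) =
      (\<Sum>i<m. if 2 * i < m then catalan i * mid_count (card R) (m - 2 * i - 1) N else 0)"
  proof (rule sum.cong[OF refl])
    fix i assume i: "i \<in> {..<m}"
    show "card {p \<in> ?Q. p a \<notin> Z \<and> p ?d = a + i} =
      (if 2 * i < m then catalan i * mid_count (card R) (m - 2 * i - 1) N else 0)"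
    proof (cases "2 * i < m")
      case True
      let ?P = "{p \<in> swap_invs a (?d - i) (Suc i). p (?d - i + i) = a + i}"
      have mid: "{a + Suc i..<?d - i} = {a + Suc i..<a + Suc i + (m - 2 * i - 1)}"
        using True by auto
      have "{p \<in> ?Q. p a \<notin> Z \<and> p ?d = a + i} = glue ?P (queue_invs R {a + Suc i..<?d - i} Z)"
        by (rule queue_invs_outer_layer) (use lt disj True in auto)
      also have "card \<dots> = card ?P * card (queue_invs R {a + Suc i..<?d - i} Z)"
      proof (rule card_glue[OF _ queue_invs_subset])
        show "?P \<subseteq> {p. inv_on ({a..<a + Suc i} \<union> {?d - i..<?d - i + Suc i}) p}"
          using swap_invs_subset by blast
        have ad: "a \<le> ?d - i" using True by simp
        have "x \<notin> Z" if "x \<in> {a..<a + Suc i} \<union> {?d - i..<?d - i + Suc i}" for x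
          using lt[of x x] that True order_trans[OF ad, of x] by auto
        then show "({a..<a + Suc i} \<union> {?d - i..<?d - i + Suc i}) \<inter> (R \<union> {a + Suc i..<?d - i} \<union> Z) = {}"
          using disj True ad by fastforce
      qed
      also have "card ?P = catalan i"
        by (rule card_swap_invs_max) (use True in simp)
      also have "card (queue_invs R {a + Suc i..<?d - i} Z) = mid_count (card R) (m - 2 * i - 1) N"
        unfolding mid Z_def by (rule IH[OF _ mid_ok_mono[OF ok]]) (use True in auto)
      finally show ?thesis using True by simp
    next
      case False
      have "{p \<in> ?Q. p a \<notin> Z \<and> p ?d = a + i} = {}"
        by (rule queue_invs_no_crossing_layer) (use lt False i in auto)
      then show ?thesis unfolding if_not_P[OF False] by (simp only: card.empty)
    qed
  qed
  finally show ?thesis by simp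
qed

text \<open>An inner induction strips the run of openers at the right end; the assumption
  \<open>IH\<close> on complete counts serves all its stages, since \<open>m\<close> only
  decreases.\<close>

lemma card_mid_min:
  assumes IH: "\<And>R a c N m'. m' \<le> m \<Longrightarrow> mid_ok R a m' c \<Longrightarrow>
      card (queue_invs R {a..<a + m'} {c..<c + N}) = mid_count (card R) m' N"
    and ok: "mid_ok R a (Suc m) c"
  shows "card {p \<in> queue_invs R {a..<Suc (a + m)} {c..<c + N}. p a \<notin> {c..<c + N}} =
    mid_count_min (card R) m N"
  using assms
proof (induction m arbitrary: R)
  case 0
  have "{p \<in> queue_invs R {a..<Suc (a + 0)} {c..<c + N}. p a \<notin> {c..<c + N}} =
    {p \<in> queue_invs R {a..<Suc (a + 0)} {c..<c + N}. p a \<notin> {c..<c + N} \<and> p (a + 0) \<notin> {c..<c + N}}"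
    by auto
  then show ?case using card_mid_minmax[of 0 R a c N] 0 by (simp only: mid_count_min.simps)
next
  case (Suc m)
  define Z where "Z = {c..<c + N}"
  let ?d = "a + Suc m"
  let ?Q = "queue_invs R {a..<Suc ?d} Z"
  have lt: "x < z" if "x \<in> R \<union> {a..<Suc ?d}" "z \<in> Z" for x z
    using mid_ok_less[OF Suc.prems(2) that(1)] that(2) by (simp add: Z_def)
  have "finite ?Q" unfolding Z_def by (rule finite_queue_invs_mid[OF Suc.prems(2)])
  then have "card {p \<in> ?Q. p a \<notin> Z} = card {p \<in> {p \<in> ?Q. p a \<notin> Z}. p ?d \<in> Z} +
      card {p \<in> {p \<in> ?Q. p a \<notin> Z}. p ?d \<notin> Z}"
    by (intro card_split) simp
  also have "{p \<in> {p \<in> ?Q. p a \<notin> Z}. p ?d \<in> Z} = {p \<in> {p \<in> ?Q. p ?d \<in> Z}. p a \<notin> Z}" by blast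
  also have "{p \<in> ?Q. p ?d \<in> Z} = queue_invs (insert ?d R) {a..<?d} Z"
    by (rule queue_invs_max_opener) (use lt in auto)
  also have "{a..<?d} = {a..<Suc (a + m)}" by simp
  also have "card {p \<in> queue_invs (insert ?d R) {a..<Suc (a + m)} Z. p a \<notin> Z} =
      mid_count_min (card (insert ?d R)) m N"
    unfolding Z_def by (rule Suc.IH) (use Suc.prems in \<open>auto simp: mid_ok_def\<close>)
  also have "card (insert ?d R) = Suc (card R)"
    using Suc.prems(2) by (intro card_insert_disjoint) (auto simp: mid_ok_def)
  also have "{p \<in> {p \<in> ?Q. p a \<notin> Z}. p ?d \<notin> Z} = {p \<in> ?Q. p a \<notin> Z \<and> p ?d \<notin> Z}" by blast
  also have "card \<dots> = mid_count_minmax (card R) (Suc m) N"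
    unfolding Z_def by (rule card_mid_minmax) (use Suc.prems in auto)
  finally show ?case by (simp add: Z_def)
qed

lemma card_queue_invs:
  "mid_ok R a m c \<Longrightarrow> card (queue_invs R {a..<a + m} {c..<c + N}) = mid_count (card R) m N"
proof (induction m arbitrary: R a c N rule: less_induct)
  case (less m)
  show ?case
  proof (cases m)
    case 0
    then show ?thesis using less.prems by (simp add: mid_ok_def card_queue_invs_no_mid)
  next
    case (Suc m')
    define Z where "Z = {c..<c + N}"
    let ?Q = "queue_invs R {a..<Suc (a + m')} Z"
    have lt: "x < z" if "x \<in> R \<union> {a..<Suc (a + m')}" "z \<in> Z" for x z
      using mid_ok_less[OF less.prems[unfolded Suc] that(1)] that(2) by (simp add: Z_def)
    have "finite ?Q" unfolding Z_def by (rule finite_queue_invs_mid[OF less.prems])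
    then have "card ?Q = card {p \<in> ?Q. p a \<in> Z} + card {p \<in> ?Q. p a \<notin> Z}" by (rule card_split)
    also have "{p \<in> ?Q. p a \<in> Z} = queue_invs (insert a R) {Suc a..<Suc (a + m')} Z"
      by (rule queue_invs_min_opener) (use lt in auto)
    also have "{Suc a..<Suc (a + m')} = {Suc a..<Suc a + m'}" by simp
    also have "card (queue_invs (insert a R) \<dots> Z) = mid_count (card (insert a R)) m' N"
      unfolding Z_def by (rule less.IH) (use less.prems Suc in \<open>auto simp: mid_ok_def\<close>)
    also have "card (insert a R) = Suc (card R)"
      using less.prems Suc by (intro card_insert_disjoint) (auto simp: mid_ok_def)
    also have "card {p \<in> ?Q. p a \<notin> Z} = mid_count_min (card R) m' N"
      unfolding Z_def by (rule card_mid_min) (use less Suc in auto)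
    finally show ?thesis using Suc by (simp add: Z_def)
  qed
qed

lemma finite_avoid_invs: "finite (avoid_invs a e)"
  by (rule finite_subset[OF avoid_invs_subset finite_inv_on]) simp

lemma finite_conn_invs: "finite (conn_invs a e)"
  by (rule finite_subset[OF conn_invs_subset finite_inv_on]) simp

lemma card_conn_invs: "card (conn_invs a (a + Suc n)) = conn_count (Suc n)"
proof (cases n)
  case 0
  then show ?thesis by (simp add: conn_invs_singleton)
next
  case (Suc n')
  let ?e = "a + Suc (Suc n')"
  have m: "a < p a \<and> p a < ?e" if "p \<in> conn_invs a ?e" for p
    using conn_invs_first_arc[OF that] by simp
  have "card (conn_invs a ?e) = (\<Sum>i\<le>n'. card {p \<in> conn_invs a ?e. p a - Suc a = i})"
    by (rule card_fibres[OF finite_conn_invs]) (use m in fastforce)+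
  also have "\<dots> = (\<Sum>i\<le>n'. mid_count 0 i (n' - i))"
  proof (rule sum.cong[OF refl])
    fix i assume i: "i \<in> {..n'}"
    let ?k = "Suc a + i"
    have "{p \<in> conn_invs a ?e. p a - Suc a = i} = {p \<in> conn_invs a ?e. p a = ?k}"
      using m by fastforce
    also have "\<dots> = glue (arc a ?k) (queue_invs {} {Suc a..<?k} {Suc ?k..<?e})"
      by (rule conn_invs_arc) (use i in auto)
    also have "card \<dots> = card (queue_invs {} {Suc a..<?k} {Suc ?k..<?e})"
    proof -
      have "{a, ?k} \<inter> ({} \<union> {Suc a..<?k} \<union> {Suc ?k..<?e}) = {}" by auto
      from card_glue[OF arc_inv_on queue_invs_subset this] show ?thesis by simp
    qed
    also have "{Suc ?k..<?e} = {Suc ?k..<Suc ?k + (n' - i)}" using i by simp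
    also have "card (queue_invs {} {Suc a..<?k} \<dots>) = mid_count (card ({} :: nat set)) i (n' - i)"
      by (rule card_queue_invs) (auto simp: mid_ok_def)
    finally show "card {p \<in> conn_invs a ?e. p a - Suc a = i} = mid_count 0 i (n' - i)" by simp
  qed
  finally show ?thesis using Suc by simp
qed

lemma card_avoid_invs: "card (avoid_invs a (a + n)) = avoid_count n"
proof (induction n arbitrary: a rule: less_induct)
  case (less n)
  show ?case
  proof (cases n)
    case 0
    then show ?thesis by (simp add: avoid_invs_empty)
  next
    case (Suc n')
    let ?e = "a + Suc n'"
    let ?B = "\<lambda>i. {p \<in> avoid_invs a ?e. first_block a (a + Suc i) p}"
    have inv: "inv_on {a..<?e} p" if "p \<in> avoid_invs a ?e" for p
      using that avoid_invs_subset by blast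
    have "avoid_invs a ?e = (\<Union>i\<in>{..n'}. ?B i)"
    proof (intro equalityI subsetI)
      fix p assume p: "p \<in> avoid_invs a ?e"
      obtain c where c: "c \<in> {a<..?e}" "first_block a c p"
        using first_block_exists[OF inv[OF p]] by auto
      then have "c = a + Suc (c - Suc a)" "c - Suc a \<le> n'" by auto
      with p c(2) show "p \<in> (\<Union>i\<in>{..n'}. ?B i)" by (metis (mono_tags, lifting) UN_I atMost_iff mem_Collect_eq)
    qed blast
    then have "card (avoid_invs a ?e) = card (\<Union>i\<in>{..n'}. ?B i)" by (rule arg_cong)
    also have "\<dots> = (\<Sum>i\<le>n'. card (?B i))"
    proof (rule card_UN_disjoint)
      show "\<forall>i\<in>{..n'}. \<forall>j\<in>{..n'}. i \<noteq> j \<longrightarrow> ?B i \<inter> ?B j = {}"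
        using first_block_unique[OF inv] by fastforce
    qed (use finite_avoid_invs in auto)
    also have "\<dots> = (\<Sum>i\<le>n'. conn_count (Suc i) * avoid_count (n' - i))"
    proof (rule sum.cong[OF refl])
      fix i assume i: "i \<in> {..n'}"
      have "?B i = glue (conn_invs a (a + Suc i)) (avoid_invs (a + Suc i) ?e)"
        by (rule avoid_invs_first_block) (use i in auto)
      also have "card \<dots> = card (conn_invs a (a + Suc i)) * card (avoid_invs (a + Suc i) ?e)"
        by (rule card_glue[OF conn_invs_subset avoid_invs_subset]) auto
      also have "card (conn_invs a (a + Suc i)) = conn_count (Suc i)" by (rule card_conn_invs)
      also have "card (avoid_invs (a + Suc i) ?e) = avoid_count (n' - i)"
        using less.IH[of "n' - i" "a + Suc i"] Suc i by simp
      finally show "card (?B i) = conn_count (Suc i) * avoid_count (n' - i)" .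
    qed
    finally show ?thesis using Suc by simp
  qed
qed

section \<open>Translation of the pattern condition\<close>

lemma contains_pattern_2431:
  "contains_pattern n p 4 pattern_2431 \<longleftrightarrow> (\<exists>i\<in>{1..n}. \<exists>j\<in>{1..n}. \<exists>k\<in>{1..n}. \<exists>l\<in>{1..n}.
     i < j \<and> j < k \<and> k < l \<and> p l < p i \<and> p i < p k \<and> p k < p j)" (is "?L \<longleftrightarrow> ?R")
proof -
  have 4: "{1..4} = {1, 2, 3, 4::nat}" by auto
  show ?thesis
  proof
    assume ?L
    then obtain idx where idx: "idx ` {1..4} \<subseteq> {1..n}" "strict_mono_on {1..4} idx"
      "\<forall>a\<in>{1..4}. \<forall>b\<in>{1..4}. p (idx a) < p (idx b) \<longleftrightarrow> pattern_2431 a < pattern_2431 b"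
      unfolding contains_pattern_def by blast
    have "idx x < idx y" if "x \<in> {1..4}" "y \<in> {1..4}" "x < y" for x y
      using idx(2) that by (rule strict_mono_onD)
    then have "idx 1 < idx 2" "idx 2 < idx 3" "idx 3 < idx 4" by auto
    moreover have "p (idx 4) < p (idx 1)" "p (idx 1) < p (idx 3)" "p (idx 3) < p (idx 2)"
      using idx(3) unfolding 4 by (simp_all add: pattern_2431_simps[simplified])
    moreover have "idx 1 \<in> {1..n}" "idx 2 \<in> {1..n}" "idx 3 \<in> {1..n}" "idx 4 \<in> {1..n}"
      using idx(1) unfolding 4 by auto
    ultimately show ?R by blast
  next
    assume ?R
    then obtain i j k l where m: "i \<in> {1..n}" "j \<in> {1..n}" "k \<in> {1..n}" "l \<in> {1..n}"
      and o: "i < j" "j < k" "k < l" "p l < p i" "p i < p k" "p k < p j" by blast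
    let ?x = "\<lambda>a::nat. if a = 1 then i else if a = 2 then j else if a = 3 then k else l"
    have "?x ` {1..4} \<subseteq> {1..n}" using m by auto
    moreover have "strict_mono_on {1..4} ?x"
      unfolding 4 using o by (auto simp: strict_mono_on_def)
    moreover have "\<forall>a\<in>{1..4}. \<forall>b\<in>{1..4}. p (?x a) < p (?x b) \<longleftrightarrow> pattern_2431 a < pattern_2431 b"
      unfolding 4 using o by (simp add: pattern_2431_simps[simplified])
    ultimately show ?L unfolding contains_pattern_def by blast
  qed
qed

lemma num_inv_avoiding_2431_eq: "num_inv_avoiding_2431 n = avoid_count n"
proof -
  have "avoids_pattern n p 4 pattern_2431 \<longleftrightarrow> avoids_2431_on {1..n} p" for p
    unfolding avoids_pattern_def contains_pattern_2431 avoids_2431_on_def not_le[symmetric] by blast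
  then have "avoiding_involutions n 4 pattern_2431 = avoid_invs 1 (1 + n)"
    unfolding avoiding_involutions_def avoid_invs_def inv_on_iff_permutes
    by (simp add: atLeastLessThanSuc_atLeastAtMost conj_assoc)
  then show ?thesis
    unfolding num_inv_avoiding_2431_def by (simp only: card_avoid_invs)
qed

section \<open>Generating functions\<close>

unbundle fps_syntax

text \<open>The Catalan series in \<open>x^2\<close>: a bijection of size \<open>n\<close> and its
  inverse occupy \<open>2 n\<close> points.\<close>

definition cat_fps :: "real fps" where
  "cat_fps = Abs_fps (\<lambda>n. if even n then real (catalan (n div 2)) else 0)"

lemma cat_fps_eq: "cat_fps = 1 + fps_X ^ 2 * cat_fps ^ 2"
proof (rule fps_ext)
  fix n
  show "cat_fps $ n = (1 + fps_X ^ 2 * cat_fps ^ 2) $ n"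
  proof (cases "n < 2")
    case True
    then have "n = 0 \<or> n = 1" by auto
    then show ?thesis by (auto simp: cat_fps_def fps_X_power_mult_nth)
  next
    case False
    then obtain m where n: "n = m + 2" by (metis add.commute le_Suc_ex not_less)
    have "(1 + fps_X ^ 2 * cat_fps ^ 2) $ n = (\<Sum>i=0..m. cat_fps $ i * cat_fps $ (m - i))"
      by (simp add: n fps_X_power_mult_nth power2_eq_square[of cat_fps] fps_mult_nth[of cat_fps cat_fps])
    also have "\<dots> = (if even m then real (\<Sum>j\<le>m div 2. catalan j * catalan (m div 2 - j)) else 0)"
    proof (cases "even m")
      case True
      then obtain h where h: "m = 2 * h" by blast
      have "(\<Sum>i=0..m. cat_fps $ i * cat_fps $ (m - i)) = (\<Sum>i\<in>(\<lambda>j. 2 * j) ` {..h}. cat_fps $ i * cat_fps $ (m - i))"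
        by (rule sum.mono_neutral_right) (auto simp: h cat_fps_def elim!: evenE)
      also have "\<dots> = (\<Sum>j\<le>h. cat_fps $ (2 * j) * cat_fps $ (m - 2 * j))"
        by (subst sum.reindex) (auto simp: inj_on_def)
      also have "\<dots> = (\<Sum>j\<le>h. real (catalan j * catalan (h - j)))"
        by (rule sum.cong) (auto simp: cat_fps_def h right_diff_distrib'[symmetric])
      finally show ?thesis using h by simp
    next
      case False
      have "cat_fps $ i * cat_fps $ (m - i) = 0" if "i \<in> {0..m}" for i
        using False that by (auto simp: cat_fps_def)
      then have "(\<Sum>i=0..m. cat_fps $ i * cat_fps $ (m - i)) = 0" by (rule sum.neutral[OF ballI])
      then show ?thesis using False by simp
    qed
    also have "\<dots> = cat_fps $ n" by (simp add: cat_fps_def n)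
    finally show ?thesis by simp
  qed
qed

text \<open>\<open>L = x c\<close> is the first-passage series for descending by one level. From
  \<open>L = x (1 + L^2)\<close> its powers satisfy \<open>L^(r+1) = x (L^r + L^(r+2))\<close>, the
  recursion of \<open>queue_count\<close>.\<close>

lemma queue_count_fps: "Abs_fps (\<lambda>N. real (queue_count r N)) = (fps_X * cat_fps) ^ r"
proof -
  define L where "L = fps_X * cat_fps"
  have L: "L = fps_X * (1 + L ^ 2)"
    unfolding L_def power_mult_distrib by (subst cat_fps_eq) (rule refl)
  have "real (queue_count r N) = (L ^ r) $ N" for N r
  proof (induction N arbitrary: r)
    case 0
    then show ?case by (cases r) (auto simp: L_def)
  next
    case (Suc N)
    show ?case
    proof (cases r)
      case 0
      then show ?thesis by simp
    next
      case (Suc r')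
      have "L ^ r = fps_X * (L ^ r' + L ^ Suc (Suc r'))"
      proof -
        have "L ^ r = L * L ^ r'" by (simp add: Suc)
        also have "\<dots> = (fps_X * (1 + L ^ 2)) * L ^ r'" by (subst L) (rule refl)
        finally show ?thesis by (simp add: algebra_simps power2_eq_square)
      qed
      then have "(L ^ r) $ Suc N = (L ^ r') $ N + (L ^ Suc (Suc r')) $ N"
        by (simp only:) simp
      then show ?thesis using Suc.IH[of r'] Suc.IH[of "Suc (Suc r')"] by (simp only: Suc queue_count.simps of_nat_add)
    qed
  qed
  then show ?thesis by (simp add: fps_eq_iff L_def)
qed

section \<open>Eliminating the queue parameter\<close>

definition mid_fps :: "nat \<Rightarrow> nat \<Rightarrow> real fps" where
  "mid_fps r m = Abs_fps (\<lambda>N. real (mid_count r m N))"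

definition mid_min_fps :: "nat \<Rightarrow> nat \<Rightarrow> real fps" where
  "mid_min_fps r m = Abs_fps (\<lambda>N. real (mid_count_min r m N))"

definition mid_minmax_fps :: "nat \<Rightarrow> nat \<Rightarrow> real fps" where
  "mid_minmax_fps r m = Abs_fps (\<lambda>N. real (mid_count_minmax r m N))"

lemma mid_fps_rec:
  "mid_fps r 0 = (fps_X * cat_fps) ^ r"
  "mid_fps r (Suc m) = mid_fps (Suc r) m + mid_min_fps r m"
  "mid_min_fps r 0 = mid_minmax_fps r 0"
  "mid_min_fps r (Suc m) = mid_min_fps (Suc r) m + mid_minmax_fps r (Suc m)"
  "mid_minmax_fps r m = fps_const (real (mid_count 0 m 0)) * (fps_X * cat_fps) ^ r +
     (\<Sum>i<m. if 2 * i < m then fps_const (real (catalan i)) * mid_fps r (m - 2 * i - 1) else 0)"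
proof -
  show "mid_minmax_fps r m = fps_const (real (mid_count 0 m 0)) * (fps_X * cat_fps) ^ r +
     (\<Sum>i<m. if 2 * i < m then fps_const (real (catalan i)) * mid_fps r (m - 2 * i - 1) else 0)"
    unfolding queue_count_fps[symmetric]
    by (rule fps_ext) (auto simp: mid_minmax_fps_def mid_fps_def fps_sum_nth intro!: sum.cong
        simp del: mult_2)
qed (simp_all add: mid_fps_def mid_min_fps_def mid_minmax_fps_def queue_count_fps[symmetric] fps_eq_iff)

text \<open>The recursions are linear and either keep \<open>r\<close> or raise it by one, and their
  base terms scale as \<open>(x c)^r\<close>; hence so do all solutions.\<close>

lemma mid_fps_power:
  "mid_fps r m = (fps_X * cat_fps) ^ r * mid_fps 0 m"
  "mid_min_fps r m = (fps_X * cat_fps) ^ r * mid_min_fps 0 m"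
  "mid_minmax_fps r m = (fps_X * cat_fps) ^ r * mid_minmax_fps 0 m"
proof -
  define L where "L = fps_X * cat_fps"
  note rec = mid_fps_rec[folded L_def]
  have "(\<forall>r. mid_fps r m = L ^ r * mid_fps 0 m) \<and> (\<forall>r. mid_min_fps r m = L ^ r * mid_min_fps 0 m) \<and>
    (\<forall>r. mid_minmax_fps r m = L ^ r * mid_minmax_fps 0 m)"
  proof (induction m rule: less_induct)
    case (less m)
    have a: "mid_fps r m = L ^ r * mid_fps 0 m" for r
    proof (cases m)
      case 0
      then show ?thesis by (simp add: rec)
    next
      case (Suc n)
      have "mid_fps r m = mid_fps (Suc r) n + mid_min_fps r n" by (simp only: Suc rec)
      also have "\<dots> = L ^ Suc r * mid_fps 0 n + L ^ r * mid_min_fps 0 n"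
        using less.IH[of n] Suc by (metis lessI)
      also have "\<dots> = L ^ r * (L ^ Suc 0 * mid_fps 0 n + mid_min_fps 0 n)" by (simp add: algebra_simps)
      also have "L ^ Suc 0 * mid_fps 0 n = mid_fps (Suc 0) n" using less.IH[of n] Suc by (metis lessI)
      also have "mid_fps (Suc 0) n + mid_min_fps 0 n = mid_fps 0 m" by (simp only: Suc rec)
      finally show ?thesis .
    qed
    have c: "mid_minmax_fps r m = L ^ r * mid_minmax_fps 0 m" for r
    proof -
      have "(\<Sum>i<m. if 2 * i < m then fps_const (real (catalan i)) * mid_fps r (m - 2 * i - 1) else 0) =
        L ^ r * (\<Sum>i<m. if 2 * i < m then fps_const (real (catalan i)) * mid_fps 0 (m - 2 * i - 1) else 0)"
        unfolding sum_distrib_left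
      proof (rule sum.cong[OF refl])
        fix i assume "i \<in> {..<m}"
        then have "m - 2 * i - 1 < m" by auto
        then have "mid_fps r (m - 2 * i - 1) = L ^ r * mid_fps 0 (m - 2 * i - 1)"
          using less.IH by blast
        then show "(if 2 * i < m then fps_const (real (catalan i)) * mid_fps r (m - 2 * i - 1) else 0) =
          L ^ r * (if 2 * i < m then fps_const (real (catalan i)) * mid_fps 0 (m - 2 * i - 1) else 0)"
          by (simp add: mult.left_commute)
      qed
      then show ?thesis unfolding rec(5)[of r m] rec(5)[of 0 m] by (simp only: power_0) (simp add: algebra_simps)
    qed
    \<comment> \<open>Comes after \<open>c\<close> because the recursion uses the third series at
      the same \<open>m\<close>.\<close>
    have b: "mid_min_fps r m = L ^ r * mid_min_fps 0 m" for r
    proof (cases m)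
      case 0
      show ?thesis unfolding 0 rec(3) by (rule c[unfolded 0])
    next
      case (Suc n)
      have "mid_min_fps r m = mid_min_fps (Suc r) n + mid_minmax_fps r m" by (simp only: Suc rec(4))
      also have "\<dots> = L ^ Suc r * mid_min_fps 0 n + L ^ r * mid_minmax_fps 0 m"
        using less.IH[of n] Suc c by (metis lessI)
      also have "\<dots> = L ^ r * (L ^ Suc 0 * mid_min_fps 0 n + mid_minmax_fps 0 m)" by (simp add: algebra_simps)
      also have "L ^ Suc 0 * mid_min_fps 0 n = mid_min_fps (Suc 0) n" using less.IH[of n] Suc by (metis lessI)
      also have "mid_min_fps (Suc 0) n + mid_minmax_fps 0 m = mid_min_fps 0 m" by (simp only: Suc rec(4))
      finally show ?thesis .
    qed
    show ?case using a b c by blast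
  qed
  then show "mid_fps r m = (fps_X * cat_fps) ^ r * mid_fps 0 m"
    "mid_min_fps r m = (fps_X * cat_fps) ^ r * mid_min_fps 0 m"
    "mid_minmax_fps r m = (fps_X * cat_fps) ^ r * mid_minmax_fps 0 m"
    unfolding L_def by blast+
qed

text \<open>\<open>diag F\<close> is the sum of \<open>fps_X ^ m * F m\<close> over all \<open>m\<close>.\<close>

definition diag :: "(nat \<Rightarrow> real fps) \<Rightarrow> real fps" where
  "diag F = Abs_fps (\<lambda>n. \<Sum>m\<le>n. F m $ (n - m))"

lemma diag_add: "diag (\<lambda>m. F m + G m) = diag F + diag G"
  by (simp add: diag_def fps_eq_iff sum.distrib)

lemma diag_Suc: "diag F = F 0 + fps_X * diag (\<lambda>m. F (Suc m))"
proof (rule fps_ext)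
  fix n show "diag F $ n = (F 0 + fps_X * diag (\<lambda>m. F (Suc m))) $ n"
    by (cases n) (simp_all add: diag_def sum.atMost_Suc_shift del: sum.atMost_Suc)
qed

lemma sum_triangle_swap:
  "(\<Sum>i\<le>n. \<Sum>j\<le>n - i. f i j) = (\<Sum>j\<le>(n::nat). \<Sum>i\<le>n - j. f i j)"
proof -
  have "{..n - i} = {j \<in> {..n}. i + j \<le> n}" if "i \<le> n" for i
    using that by auto
  moreover have "{..n - j} = {i \<in> {..n}. i + j \<le> n}" if "j \<le> n" for j
    using that by auto
  ultimately show ?thesis
    using sum.swap_restrict[of "{..n}" "{..n}" f "\<lambda>i j. i + j \<le> n"] by simp
qed

lemma diag_mult_left: "diag (\<lambda>m. G * F m) = G * diag F"
proof (rule fps_ext)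
  fix n
  have "diag (\<lambda>m. G * F m) $ n = (\<Sum>m\<le>n. \<Sum>i\<le>n - m. G $ i * F m $ (n - m - i))"
    by (simp add: diag_def fps_mult_nth atMost_atLeast0)
  also have "\<dots> = (\<Sum>i\<le>n. \<Sum>m\<le>n - i. G $ i * F m $ (n - m - i))"
    by (rule sum_triangle_swap)
  also have "\<dots> = (G * diag F) $ n"
    by (simp add: diag_def fps_mult_nth atMost_atLeast0 sum_distrib_left add.commute)
  finally show "diag (\<lambda>m. G * F m) $ n = (G * diag F) $ n" .
qed

text \<open>The index \<open>m\<close> and the variable inside \<open>F m\<close> are both marked by
  \<open>x\<close> in \<open>diag\<close>, so a convolution over \<open>m\<close> also becomes a
  product.\<close>

lemma diag_convolution: "diag (\<lambda>m. \<Sum>j\<le>m. fps_const (c $ j) * F (m - j)) = c * diag F"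
proof (rule fps_ext)
  fix n
  define f where "f j i = c $ j * F i $ (n - (j + i))" for j i
  have "diag (\<lambda>m. \<Sum>j\<le>m. fps_const (c $ j) * F (m - j)) $ n = (\<Sum>m\<le>n. \<Sum>j\<le>m. f j (m - j))"
    by (simp add: diag_def fps_sum_nth f_def)
  also have "\<dots> = (\<Sum>(j, i)\<in>{(j, i). j + i \<le> n}. f j i)"
    by (rule sum.triangle_reindex_eq[symmetric])
  also have "{(j, i). j + i \<le> n} = Sigma {..n} (\<lambda>j. {..n - j})"
    by auto
  also have "(\<Sum>(j, i)\<in>Sigma {..n} (\<lambda>j. {..n - j}). f j i) = (\<Sum>j\<le>n. \<Sum>i\<le>n - j. f j i)"
    by (rule sum.Sigma[symmetric]) auto
  also have "\<dots> = (c * diag F) $ n"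
    by (simp add: diag_def fps_mult_nth atMost_atLeast0 sum_distrib_left f_def)
  finally show "diag (\<lambda>m. \<Sum>j\<le>m. fps_const (c $ j) * F (m - j)) $ n = (c * diag F) $ n" .
qed

definition layer_sum :: "(nat \<Rightarrow> real fps) \<Rightarrow> nat \<Rightarrow> real fps" where
  "layer_sum F m = (\<Sum>i<m. if 2 * i < m then fps_const (real (catalan i)) * F (m - 2 * i - 1) else 0)"

text \<open>With \<open>j = 2 * i\<close> the guarded sum is a convolution with
  \<open>cat_fps\<close>, whose odd coefficients vanish. The shift to \<open>Suc k\<close> becomes
  the factor \<open>fps_X\<close> in \<open>diag_layer_sum\<close>.\<close>

lemma layer_sum_Suc: "layer_sum F (Suc k) = (\<Sum>j\<le>k. fps_const (cat_fps $ j) * F (k - j))"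
proof -
  have "layer_sum F (Suc k) = (\<Sum>i\<in>{i \<in> {..<Suc k}. 2 * i < Suc k}. fps_const (real (catalan i)) * F (k - 2 * i))"
    unfolding layer_sum_def by (subst sum.inter_filter) (auto intro: sum.cong)
  also have "\<dots> = (\<Sum>i\<in>{i. 2 * i \<le> k}. fps_const (cat_fps $ (2 * i)) * F (k - 2 * i))"
    by (rule sum.cong) (auto simp: cat_fps_def)
  also have "\<dots> = (\<Sum>j\<in>(\<lambda>i. 2 * i) ` {i. 2 * i \<le> k}. fps_const (cat_fps $ j) * F (k - j))"
    by (subst sum.reindex) (auto simp: inj_on_def)
  also have "\<dots> = (\<Sum>j\<le>k. fps_const (cat_fps $ j) * F (k - j))"
    by (rule sum.mono_neutral_left) (auto simp: cat_fps_def elim!: evenE)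
  finally show ?thesis .
qed

lemma diag_layer_sum: "diag (layer_sum F) = fps_X * cat_fps * diag F"
  by (subst diag_Suc) (simp add: layer_sum_Suc diag_convolution layer_sum_def[of F 0] mult.assoc)

lemma diag_const: "diag (\<lambda>m. fps_const (f m)) = Abs_fps f"
proof (rule fps_ext)
  fix n
  have "diag (\<lambda>m. fps_const (f m)) $ n = (\<Sum>m\<le>n. if m = n then f m else 0)"
    by (auto simp: diag_def intro!: sum.cong)
  then show "diag (\<lambda>m. fps_const (f m)) $ n = Abs_fps f $ n" by simp
qed

section \<open>Functional equations of the series\<close>

definition inv132_fps :: "real fps" where
  "inv132_fps = Abs_fps (\<lambda>m. real (mid_count 0 m 0))"

text \<open>Obtained from the recursions at \<open>N = 0\<close>: a nonempty queue contributes a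
  positive power of \<open>x c\<close>, which has no constant term, so all terms with openers
  disappear.\<close>

lemma inv132_fps_eq: "inv132_fps = 1 + fps_X * inv132_fps + fps_X ^ 2 * cat_fps * inv132_fps"
proof -
  define b where "b m = real (mid_count 0 m 0)" for m
  have b0: "b 0 = 1" by (simp add: b_def)
  have bS: "fps_const (b (Suc m)) = fps_const (b m) + layer_sum (\<lambda>m. fps_const (b m)) m" for m
  proof -
    have z: "mid_fps (Suc r) m $ 0 = 0" "mid_min_fps (Suc r) m $ 0 = 0" for r m
      by (simp_all add: mid_fps_power(1)[of "Suc r"] mid_fps_power(2)[of "Suc r"])
    have mm: "mid_min_fps 0 m $ 0 = mid_minmax_fps 0 m $ 0"
      by (cases m) (simp_all add: mid_fps_rec(3,4) z)
    have "b (Suc m) = mid_fps 0 (Suc m) $ 0" by (simp add: b_def mid_fps_def)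
    also have "\<dots> = mid_minmax_fps 0 m $ 0" by (simp add: mid_fps_rec(2) z mm)
    also have "\<dots> = b m + (\<Sum>i<m. if 2 * i < m then real (catalan i) * b (m - 2 * i - 1) else 0)"
      by (auto simp: mid_minmax_fps_def b_def intro!: sum.cong)
    finally have b: "b (Suc m) = \<dots>" .
    show ?thesis
    proof (rule fps_ext)
      fix n show "fps_const (b (Suc m)) $ n = (fps_const (b m) + layer_sum (\<lambda>m. fps_const (b m)) m) $ n"
        by (cases n) (auto simp: b layer_sum_def fps_sum_nth intro!: sum.cong sum.neutral)
    qed
  qed
  have "inv132_fps = diag (\<lambda>m. fps_const (b m))"
    by (simp add: diag_const inv132_fps_def b_def)
  also have "\<dots> = 1 + fps_X * diag (\<lambda>m. fps_const (b (Suc m)))"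
    by (subst diag_Suc) (simp add: b0)
  also have "diag (\<lambda>m. fps_const (b (Suc m))) = inv132_fps + fps_X * cat_fps * inv132_fps"
    unfolding bS diag_add diag_layer_sum by (simp add: diag_const inv132_fps_def b_def)
  finally show ?thesis by (simp add: algebra_simps power2_eq_square)
qed

text \<open>\<open>E1\<close> and \<open>E2\<close> are indexed by one less than the size of the
  middle, hence the extra \<open>fps_X\<close> before \<open>E1\<close>. The coefficient
  \<open>fps_X ^ 2 * cat_fps\<close> is the weight of one opener.\<close>

lemma diag_mid_eqs:
  defines "E \<equiv> diag (mid_fps 0)" and "E1 \<equiv> diag (mid_min_fps 0)" and "E2 \<equiv> diag (mid_minmax_fps 0)"
  shows "E = 1 + fps_X ^ 2 * cat_fps * E + fps_X * E1"
    "E1 = fps_X ^ 2 * cat_fps * E1 + E2"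
    "E2 = inv132_fps + fps_X * cat_fps * E"
proof -
  have 1: "mid_fps (Suc 0) m = fps_X * cat_fps * mid_fps 0 m"
    "mid_min_fps (Suc 0) m = fps_X * cat_fps * mid_min_fps 0 m" for m
    using mid_fps_power[of "Suc 0" m] by simp_all
  show "E = 1 + fps_X ^ 2 * cat_fps * E + fps_X * E1"
    unfolding E_def
    by (subst diag_Suc) (simp add: mid_fps_rec(1,2) 1 diag_add diag_mult_left E1_def algebra_simps power2_eq_square)
  have "E1 = mid_minmax_fps 0 0 + fps_X * (fps_X * cat_fps * E1 + diag (\<lambda>m. mid_minmax_fps 0 (Suc m)))"
    unfolding E1_def
    by (subst diag_Suc) (simp only: mid_fps_rec(3,4) 1 diag_add diag_mult_left)
  \<comment> \<open>Expanding \<open>E2\<close> the same way lets the two remainders of the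
    expansion of \<open>E1\<close> be collected into \<open>E2\<close>.\<close>
  moreover have "E2 = mid_minmax_fps 0 0 + fps_X * diag (\<lambda>m. mid_minmax_fps 0 (Suc m))"
    unfolding E2_def by (rule diag_Suc)
  ultimately show "E1 = fps_X ^ 2 * cat_fps * E1 + E2"
    by (simp add: algebra_simps power2_eq_square)
  have "mid_minmax_fps 0 = (\<lambda>m. fps_const (real (mid_count 0 m 0)) + layer_sum (mid_fps 0) m)"
    by (rule ext) (simp add: mid_fps_rec(5)[of 0] layer_sum_def)
  then show "E2 = inv132_fps + fps_X * cat_fps * E"
    unfolding E2_def E_def inv132_fps_def by (simp only: diag_add diag_const diag_layer_sum)
qed

definition avoid_fps :: "real fps" where
  "avoid_fps = Abs_fps (\<lambda>n. real (avoid_count n))"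

lemma avoid_fps_eq: "avoid_fps = 1 + (fps_X + fps_X ^ 2 * diag (mid_fps 0)) * avoid_fps"
proof -
  \<comment> \<open>The series of connected avoiders divided by \<open>x\<close>.\<close>
  define C where "C = Abs_fps (\<lambda>n. real (conn_count (Suc n)))"
  have C: "C = 1 + fps_X * diag (mid_fps 0)"
  proof (rule fps_ext)
    fix n show "C $ n = (1 + fps_X * diag (mid_fps 0)) $ n"
      by (cases n) (simp_all add: C_def diag_def mid_fps_def)
  qed
  have conv: "(C * avoid_fps) $ n = (\<Sum>i\<le>n. real (conn_count (Suc i)) * real (avoid_count (n - i)))" for n
    by (simp add: C_def avoid_fps_def fps_mult_nth atMost_atLeast0)
  have nth: "avoid_fps $ n = real (avoid_count n)" for n
    by (simp add: avoid_fps_def)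
  have "avoid_fps = 1 + fps_X * (C * avoid_fps)"
  proof (rule fps_ext)
    fix n show "avoid_fps $ n = (1 + fps_X * (C * avoid_fps)) $ n"
      by (cases n) (simp_all add: conv nth)
  qed
  then show ?thesis by (simp add: C algebra_simps power2_eq_square)
qed

text \<open>Completing the square in the quadratic equation for \<open>cat_fps\<close>; the constant
  term 1 selects the root.\<close>

lemma fps_sqrt_cat: "fps_sqrt (1 - 4 * fps_X ^ 2) = 1 - 2 * fps_X ^ 2 * cat_fps"
proof -
  have "(1 - 2 * fps_X ^ 2 * cat_fps) ^ 2 = 1 - 4 * fps_X ^ 2"
  proof -
    \<comment> \<open>The summand \<open>1 + ... - 1\<close> exposes the right-hand side of
      \<open>cat_fps_eq\<close>, so that it can be folded.\<close>
    have "(1 - 2 * fps_X ^ 2 * cat_fps) ^ 2 =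
        1 - 4 * fps_X ^ 2 * cat_fps + 4 * fps_X ^ 2 * (1 + fps_X ^ 2 * cat_fps ^ 2 - 1)"
      by (simp add: algebra_simps power2_eq_square)
    also have "\<dots> = 1 - 4 * fps_X ^ 2"
      unfolding cat_fps_eq[symmetric] by (simp add: algebra_simps)
    finally show ?thesis .
  qed
  moreover have "(1 - 2 * fps_X ^ 2 * cat_fps) $ 0 = 1"
    by simp
  ultimately show ?thesis
    using fps_sqrt_unique[of "1 - 4 * fps_X ^ 2" "1 - 2 * fps_X ^ 2 * cat_fps"] by simp
qed

theorem theorem2:
  shows "Abs_fps (\<lambda>n. real (num_inv_avoiding_2431 n)) =
    (1 - 2 * fps_X - 5 * fps_X ^ 2 + 8 * fps_X ^ 3 + 3 * fps_X ^ 4 + 2 * fps_X ^ 5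
       + fps_X ^ 4 * fps_sqrt (1 - 4 * fps_X ^ 2))
    / ((1 - fps_X) * (1 - 2 * fps_X - 6 * fps_X ^ 2 + 8 * fps_X ^ 3 + 8 * fps_X ^ 4 + 4 * fps_X ^ 5))"
    (is "?A = ?num / ?den")
proof -
  define X :: "real fps" where "X = fps_X"
  define c where "c = cat_fps"
  define E where "E = diag (mid_fps 0)"
  \<comment> \<open>Division is avoided by clearing denominators: \<open>E\<close> is
    \<open>w / u\<close>, and the series of avoiders, \<open>1 / (1 - X - X ^ 2 * E)\<close>, is
    \<open>u / v\<close>.\<close>
  define u where "u = (1 - X ^ 2 * c ^ 3) * (1 - X - X ^ 2 * c)"
  define w where "w = c * (1 - X - X ^ 2 * c) + c ^ 2 * X"
  define v where "v = (1 - X) * u - X ^ 2 * w"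
  have c: "c = 1 + X ^ 2 * c ^ 2"
    using cat_fps_eq by (simp add: c_def X_def)
  have Eu: "E * u = w"
  proof -
    define E1 where "E1 = diag (mid_min_fps 0)"
    define E2 where "E2 = diag (mid_minmax_fps 0)"
    have "E = 1 + X ^ 2 * c * E + X * E1" "E1 = X ^ 2 * c * E1 + E2" "E2 = inv132_fps + X * c * E"
      and "inv132_fps = 1 + X * inv132_fps + X ^ 2 * c * inv132_fps"
      using diag_mid_eqs inv132_fps_eq by (simp_all only: E_def E1_def E2_def X_def c_def)
    note eqs = this
    \<comment> \<open>So \<open>c\<close> is the geometric series of a run of openers; it inverts
      the coefficients of \<open>E1\<close> and \<open>E\<close>.\<close>
    have ct: "c * (1 - X ^ 2 * c) = 1" using c by algebra
    have E1: "E1 = c * E2"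
    proof -
      have "E1 * (1 - X ^ 2 * c) = E2" using eqs(2) by algebra
      with ct show ?thesis by algebra
    qed
    have "E = c * (1 + X * E1)"
    proof -
      have "E * (1 - X ^ 2 * c) = 1 + X * E1" using eqs(1) by algebra
      with ct show ?thesis by algebra
    qed
    then have "E * (1 - X ^ 2 * c ^ 3) = c + c ^ 2 * X * inv132_fps"
      unfolding E1 eqs(3) by algebra
    moreover have "inv132_fps * (1 - X - X ^ 2 * c) = 1" using eqs(4) by algebra
    ultimately show ?thesis
      unfolding u_def w_def by algebra
  qed
  have "avoid_fps = 1 + (X + X ^ 2 * E) * avoid_fps"
    unfolding X_def E_def by (rule avoid_fps_eq)
  then have Av: "avoid_fps * v = u"
    unfolding v_def using Eu by algebra
  define N where "N = 1 - 2 * X - 5 * X ^ 2 + 8 * X ^ 3 + 3 * X ^ 4 + 2 * X ^ 5 + X ^ 4 * (1 - 2 * X ^ 2 * c)"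
  define D where "D = (1 - X) * (1 - 2 * X - 6 * X ^ 2 + 8 * X ^ 3 + 8 * X ^ 4 + 4 * X ^ 5)"
  \<comment> \<open>The long factor is the quotient of \<open>D * u - N * v\<close>, as a polynomial
    in \<open>c\<close>, by \<open>1 - c + X ^ 2 * c ^ 2\<close>, which vanishes by the equation for
    \<open>c\<close>.\<close>
  have "D * u - N * v = (1 - c + X ^ 2 * c ^ 2) *
    ((2 * X ^ 3 - X ^ 2 + 3 * X ^ 4 - 6 * X ^ 5 + 2 * X ^ 7)
      + (X ^ 4 - X ^ 3 + 6 * X ^ 5 - 6 * X ^ 6 - 2 * X ^ 7 + 2 * X ^ 8) * c
      + (X ^ 5 - X ^ 4 + 4 * X ^ 6 - 4 * X ^ 8) * c ^ 2 + (2 * X ^ 8 - 2 * X ^ 9) * c ^ 3)"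
    unfolding N_def D_def v_def u_def w_def by algebra
  also have "1 - c + X ^ 2 * c ^ 2 = 0" using c by algebra
  finally have "D * u = N * v" by simp
  then have "(avoid_fps * D) * v = N * v"
    using Av by algebra
  moreover have "v $ 0 = 1"
    by (simp add: v_def u_def w_def X_def)
  then have "v \<noteq> 0" by auto
  ultimately have "avoid_fps * D = N" by simp
  moreover have "D $ 0 = 1" by (simp add: D_def X_def)
  then have "D \<noteq> 0" by auto
  ultimately have "avoid_fps = N / D" by (metis nonzero_mult_div_cancel_right)
  moreover have "?A = avoid_fps"
    by (simp add: avoid_fps_def num_inv_avoiding_2431_eq)
  moreover have "N = ?num" "D = ?den"
    by (simp_all add: N_def D_def X_def c_def fps_sqrt_cat)
  ultimately show ?thesis by simp
qed

end
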